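(* Switch Set Cover, parameterized by the combined parameter consisting of the number $c$ of colors and the number $k$ of switches, is or-compositional.
   Context: Let $C$ be a finite set of colors. A $C$-position is a multiset of elements of $C$; a $C$-switch is a multiset of $C$-positions. Switch Set Cover: Input: a set $C$ of $c$ colors and $k$ $C$-switches. Question: is it possible to choose exactly one position in each switch such that every color of $C$ is contained in at least one chosen position? An or-composition algorithm for a parameterized problem $(Q,\kappa)$ receives instances $I_1,\dots,I_m$ with $\kappa(I_1)=\dots=\kappa(I_m)=p$, runs in time polynomial in $\sum_i|I_i|+p$, and outputs an instance $I^*$ with $\kappa(I^* )$ bounded by a polynomial in $p$ such that $I^*\in Q$ iff $I_j\in Q$ for some $j$. A parameterized problem is or-compositional if it has an or-composition algorithm. *)

theory Defs
  imports "HOL-Library.Multiset" "HOL-Computational_Algebra.Polynomial"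
begin

section \<open>Machine model\<close>

text \<open>
  Running times are measured in Jones' WHILE language over binary trees.  Evaluating an
  expression is charged the size of the value of each of its subexpressions (so duplicating a
  tree is not a unit-cost operation).  With this charge the size of the
  store grows at most by the time spent, and the functions computable in polynomial time are
  those of polynomial-time Turing machines.
\<close>

datatype data = Leaf | Node data data

primrec data_size :: "data \<Rightarrow> nat" where
  "data_size Leaf = 1"
| "data_size (Node a b) = 1 + data_size a + data_size b"

primrec left :: "data \<Rightarrow> data" where
  "left Leaf = Leaf"
| "left (Node a b) = a"

primrec right :: "data \<Rightarrow> data" where
  "right Leaf = Leaf"
| "right (Node a b) = b"

datatype expr =
    Var nat
  | Const data
  | Join expr expr
  | Hd expr
  | Tl expr
  | Equal expr expr

datatype prog =
    Assign nat expr
  | Seq prog prog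
  | Cond expr prog prog
  | While expr prog

type_synonym store = "nat \<Rightarrow> data"

primrec val :: "expr \<Rightarrow> store \<Rightarrow> data" where
  "val (Var x) s = s x"
| "val (Const d) s = d"
| "val (Join e f) s = Node (val e s) (val f s)"
| "val (Hd e) s = left (val e s)"
| "val (Tl e) s = right (val e s)"
| "val (Equal e f) s = (if val e s = val f s then Node Leaf Leaf else Leaf)"

primrec cost :: "expr \<Rightarrow> store \<Rightarrow> nat" where
  "cost (Var x) s = data_size (val (Var x) s)"
| "cost (Const d) s = data_size (val (Const d) s)"
| "cost (Join e f) s = cost e s + cost f s + data_size (val (Join e f) s)"
| "cost (Hd e) s = cost e s + data_size (val (Hd e) s)"
| "cost (Tl e) s = cost e s + data_size (val (Tl e) s)"
| "cost (Equal e f) s = cost e s + cost f s + data_size (val (Equal e f) s)"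

text \<open>\<open>exec A s t s'\<close>: started in store \<open>s\<close>, program \<open>A\<close> terminates after time \<open>t\<close> in store
  \<open>s'\<close>.  As a truth value, \<^const>\<open>Leaf\<close> is false and every other tree is true.\<close>

inductive exec :: "prog \<Rightarrow> store \<Rightarrow> nat \<Rightarrow> store \<Rightarrow> bool" where
  Assign: "exec (Assign x e) s (1 + cost e s) (s(x := val e s))"
| Seq: "exec A s t s' \<Longrightarrow> exec B s' t' s'' \<Longrightarrow> exec (Seq A B) s (t + t') s''"
| CondTrue: "val e s \<noteq> Leaf \<Longrightarrow> exec A s t s' \<Longrightarrow> exec (Cond e A B) s (1 + cost e s + t) s'"
| CondFalse: "val e s = Leaf \<Longrightarrow> exec B s t s' \<Longrightarrow> exec (Cond e A B) s (1 + cost e s + t) s'"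
| WhileFalse: "val e s = Leaf \<Longrightarrow> exec (While e A) s (1 + cost e s) s"
| WhileTrue: "val e s \<noteq> Leaf \<Longrightarrow> exec A s t s' \<Longrightarrow> exec (While e A) s' t' s'' \<Longrightarrow>
    exec (While e A) s (1 + cost e s + t + t') s''"


lemma exec_deterministic:
  "exec A s t s' \<Longrightarrow> exec A s u s'' \<Longrightarrow> t = u \<and> s' = s''"
proof (induction arbitrary: u s'' rule: exec.induct)
  case (Assign x e s)
  from Assign.prems show ?case by (cases rule: exec.cases) simp_all
next
  case (Seq A s t s' B t' r)
  from Seq.prems obtain u1 u2 v where "exec A s u1 v" "exec B v u2 s''" "u = u1 + u2"
    by (cases rule: exec.cases) auto
  with Seq.IH(1)[of u1 v] Seq.IH(2)[of u2 s''] show ?case by simp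
next
  case (CondTrue e s A t s' B)
  from CondTrue.prems CondTrue.hyps(1) obtain u1 where "exec A s u1 s''" "u = 1 + cost e s + u1"
    by (cases rule: exec.cases) auto
  with CondTrue.IH[of u1 s''] show ?case by simp
next
  case (CondFalse e s B t s' A)
  from CondFalse.prems CondFalse.hyps(1) obtain u1 where "exec B s u1 s''" "u = 1 + cost e s + u1"
    by (cases rule: exec.cases) auto
  with CondFalse.IH[of u1 s''] show ?case by simp
next
  case (WhileFalse e s A)
  from WhileFalse.prems WhileFalse.hyps show ?case by (cases rule: exec.cases) simp_all
next
  case (WhileTrue e s A t s' t' r)
  from WhileTrue.prems WhileTrue.hyps(1) obtain u1 v u2
    where "exec A s u1 v" "exec (While e A) v u2 s''" "u = 1 + cost e s + u1 + u2"
    by (cases rule: exec.cases) auto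
  with WhileTrue.IH(1)[of u1 v] WhileTrue.IH(2)[of u2 s''] show ?case by simp
qed

text \<open>Variable 0 holds the input at the start and the output at the end.\<close>

definition computes_in :: "prog \<Rightarrow> data \<Rightarrow> data \<Rightarrow> nat \<Rightarrow> bool" where
  "computes_in A d d' t \<longleftrightarrow> (\<exists>s. exec A ((\<lambda>_. Leaf)(0 := d)) t s \<and> s 0 = d')"


section \<open>Parameterized problems and or-composition\<close>

text \<open>An instance may have several codes, for example since the elements of a set or multiset
  have to be listed in some order.  The input size of an instance is the size of the code at
  hand.\<close>

record 'i parameterized_problem =
  instances :: "'i set"
  yes_instances :: "'i set"
  parameter :: "'i \<Rightarrow> nat"
  encodes :: "data \<Rightarrow> 'i \<Rightarrow> bool"

primrec list_data :: "data list \<Rightarrow> data" where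
  "list_data [] = Leaf"
| "list_data (d # ds) = Node d (list_data ds)"

definition or_composition_algorithm :: "prog \<Rightarrow> 'i parameterized_problem \<Rightarrow> bool" where
  "or_composition_algorithm A P \<longleftrightarrow>
    (\<exists>(time_bound :: nat poly) (param_bound :: nat poly).
      \<forall>Is ds p.
        Is \<noteq> [] \<and> set Is \<subseteq> instances P \<and> (\<forall>I\<in>set Is. parameter P I = p) \<and>
        list_all2 (encodes P) ds Is \<longrightarrow>
        (\<exists>d t J.
          computes_in A (list_data ds) d t \<and>
          t \<le> poly time_bound (sum_list (map data_size ds) + p) \<and>
          J \<in> instances P \<and> encodes P d J \<and>
          parameter P J \<le> poly param_bound p \<and>
          (J \<in> yes_instances P \<longleftrightarrow> (\<exists>I\<in>set Is. I \<in> yes_instances P))))"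

definition or_compositional :: "'i parameterized_problem \<Rightarrow> bool" where
  "or_compositional P \<longleftrightarrow> (\<exists>A. or_composition_algorithm A P)"


section \<open>Switch Set Cover\<close>

type_synonym color = nat
type_synonym position = "color multiset"
type_synonym switch = "position multiset"
type_synonym ssc_instance = "color set \<times> switch list"

definition is_position :: "color set \<Rightarrow> position \<Rightarrow> bool" where
  "is_position C p \<longleftrightarrow> set_mset p \<subseteq> C"

definition is_switch :: "color set \<Rightarrow> switch \<Rightarrow> bool" where
  "is_switch C s \<longleftrightarrow> (\<forall>p \<in># s. is_position C p)"

definition ssc_instances :: "ssc_instance set" where
  "ssc_instances = {(C, S). finite C \<and> (\<forall>s \<in> set S. is_switch C s)}"

definition ssc_yes :: "ssc_instance set" where
  "ssc_yes = {(C, S). (C, S) \<in> ssc_instances \<and>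
    (\<exists>choice :: nat \<Rightarrow> position.
      (\<forall>i < length S. choice i \<in># S ! i) \<and>
      (\<forall>c \<in> C. \<exists>i < length S. c \<in># choice i))}"

fun ssc_parameter :: "ssc_instance \<Rightarrow> nat" where
  "ssc_parameter (C, S) = card C + length S"

text \<open>Binary representation, least significant bit first.\<close>

fun nat_data :: "nat \<Rightarrow> data" where
  "nat_data n =
    (if n = 0 then Leaf
     else Node (if odd n then Node Leaf Leaf else Leaf) (nat_data (n div 2)))"

declare nat_data.simps [simp del]

definition position_data :: "color list \<Rightarrow> data" where
  "position_data p = list_data (map nat_data p)"

definition switch_data :: "color list list \<Rightarrow> data" where
  "switch_data s = list_data (map position_data s)"

fun ssc_encodes :: "data \<Rightarrow> ssc_instance \<Rightarrow> bool" where
  "ssc_encodes d (C, S) \<longleftrightarrow>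
    (\<exists>(cs :: color list) (ss :: color list list list).
      distinct cs \<and> C = set cs \<and> S = map (\<lambda>s. mset (map mset s)) ss \<and>
      d = Node (list_data (map nat_data cs)) (list_data (map switch_data ss)))"

definition switch_set_cover :: "ssc_instance parameterized_problem" where
  "switch_set_cover =
    \<lparr>instances = ssc_instances, yes_instances = ssc_yes,
     parameter = ssc_parameter, encodes = ssc_encodes\<rparr>"

text \<open>Every instance has a code, and a code determines the instance.\<close>

lemma nat_data_0: "nat_data 0 = Leaf"
  by (subst nat_data.simps) simp

lemma nat_data_pos:
  "n \<noteq> 0 \<Longrightarrow> nat_data n = Node (if odd n then Node Leaf Leaf else Leaf) (nat_data (n div 2))"
  by (subst nat_data.simps) simp

lemma inj_nat_data: "inj nat_data"
proof (rule injI)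
  fix m n show "nat_data m = nat_data n \<Longrightarrow> m = n"
  proof (induction m arbitrary: n rule: less_induct)
    case (less m)
    consider "m = 0" | "n = 0" | "m \<noteq> 0" "n \<noteq> 0" by blast
    then show ?case
    proof cases
      case 1
      with less.prems show ?thesis using nat_data_pos[of n] by (cases "n = 0") (simp_all add: nat_data_0)
    next
      case 2
      with less.prems show ?thesis using nat_data_pos[of m] by (cases "m = 0") (simp_all add: nat_data_0)
    next
      case 3
      then have eq: "odd m = odd n" "nat_data (m div 2) = nat_data (n div 2)"
        using less.prems unfolding nat_data_pos[OF 3(1)] nat_data_pos[OF 3(2)]
        by (simp_all split: if_splits)
      have "m div 2 < m" using 3(1) by simp
      then have "m div 2 = n div 2" using eq(2) by (rule less.IH)
      moreover have "m mod 2 = n mod 2" using eq(1) by presburger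
      ultimately show ?thesis by (metis div_mult_mod_eq)
    qed
  qed
qed

lemma inj_list_data: "inj list_data"
proof (rule injI)
  fix xs ys show "list_data xs = list_data ys \<Longrightarrow> xs = ys"
  proof (induction xs arbitrary: ys)
    case Nil
    then show ?case by (cases ys) auto
  next
    case (Cons x xs)
    then show ?case by (cases ys) auto
  qed
qed

lemma inj_switch_data: "inj switch_data"
proof -
  have "inj position_data"
    unfolding inj_def position_data_def
    by (auto simp: inj_eq[OF inj_list_data] inj_map_eq_map[OF inj_nat_data])
  then show ?thesis
    unfolding inj_def[of switch_data] switch_data_def
    by (auto simp: inj_eq[OF inj_list_data] inj_map_eq_map)
qed

lemma ssc_encodes_unique:
  assumes "ssc_encodes d I" and "ssc_encodes d J"
  shows "I = J"
proof -
  obtain cs ss where I: "I = (set cs, map (\<lambda>s. mset (map mset s)) ss)"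
      "d = Node (list_data (map nat_data cs)) (list_data (map switch_data ss))"
    using assms(1) by (cases I) auto
  obtain cs' ss' where J: "J = (set cs', map (\<lambda>s. mset (map mset s)) ss')"
      "d = Node (list_data (map nat_data cs')) (list_data (map switch_data ss'))"
    using assms(2) by (cases J) auto
  have "map nat_data cs = map nat_data cs'" "map switch_data ss = map switch_data ss'"
    using I(2) J(2) by (simp_all add: inj_eq[OF inj_list_data])
  then have "cs = cs'" "ss = ss'"
    using inj_nat_data inj_switch_data by (auto simp: inj_map_eq_map)
  then show ?thesis using I(1) J(1) by simp
qed

lemma ssc_encodes_total:
  assumes "I \<in> ssc_instances"
  shows "\<exists>d. ssc_encodes d I"
proof -
  obtain C S where I: "I = (C, S)" by (cases I)
  with assms have "finite C" by (simp add: ssc_instances_def)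
  then obtain cs where cs: "distinct cs" "C = set cs" by (metis finite_distinct_list)
  have "\<exists>s'. s = mset (map mset s')" for s :: switch
  proof -
    obtain l where l: "mset l = s" using ex_mset by blast
    have "\<exists>s'. l = map mset s'" by (simp add: ex_map_conv) (metis ex_mset)
    with l show ?thesis by blast
  qed
  then have "\<exists>ss. S = map (\<lambda>s. mset (map mset s)) ss"
    by (simp add: ex_map_conv)
  then obtain ss where "S = map (\<lambda>s. mset (map mset s)) ss" by blast
  with cs show ?thesis unfolding I ssc_encodes.simps by blast
qed

end

(* Composing all instances into one costs about log m colours per switch for identifying the
   instance that a chosen position comes from, which is affordable only if m <= 2^p.  If m > 2^p, then
   all instances can be solved outright: a table indexed by the subsets of the at most p colours
   of an instance has polynomial size in m.  If m <= 2^p, then the instances get distinct subsets T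
   of a p-element set as identifiers.  The i-th switches of all instances are merged into one
   switch, and a hub switch with one position per instance is added; additional colours can only be
   covered if all the chosen positions carry the identifier of the position chosen at the hub.
   Instances with fewer than p colours or switches are padded.

   Running times are bounded through a class of polynomial-time functions on trees that is
   closed under composition, case distinction and folds with polynomially bounded accumulators. *)

theory Submission
  imports Defs
begin

section \<open>Trees as lists\<close>

text \<open>The obstacle is that a choice in the merged switches may mix positions of different
  instances. Forcing agreement takes colours that recognise an instance, and only polynomially many
  in p may be added, whatever m is. Telling m instances apart takes log m bits, and each bit takes
  two colours per switch, one for each value: a position of merged switch i provides one of the two,
  the position at the hub the other one, so both are covered exactly if the bits coincide. One set Q
  of p = c + k names plays three roles: its members are colours, indices of switches, and elements
  of the identifying subsets. Only the sum c + k is common to the instances, hence both numbers are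
  padded to p. This yields p + 2p^2 colours and p + 1 switches.\<close>

primrec elems :: "data \<Rightarrow> data list" where
  "elems Leaf = []"
| "elems (Node a b) = a # elems b"

lemma elems_list_data [simp]: "elems (list_data ds) = ds"
  by (induction ds) simp_all

lemma list_data_elems [simp]: "list_data (elems d) = d"
  by (induction d) simp_all

lemma list_data_eq_Leaf [simp]: "list_data ds = Leaf \<longleftrightarrow> ds = []"
  by (cases ds) simp_all

lemma data_size_pos [simp]: "0 < data_size d"
  by (cases d) simp_all

lemma data_size_list_data: "data_size (list_data ds) = 1 + (\<Sum>d\<leftarrow>ds. 1 + data_size d)"
  by (induction ds) simp_all

lemma data_size_elems: "data_size d = 1 + (\<Sum>x\<leftarrow>elems d. 1 + data_size x)"
  using data_size_list_data[of "elems d"] by simp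

lemma length_elems_less: "length (elems d) < data_size d"
  by (induction d) simp_all

lemma data_size_elem_less: "x \<in> set (elems d) \<Longrightarrow> data_size x < data_size d"
  by (induction d) auto

lemma data_size_left_le: "data_size (left d) \<le> data_size d"
  by (cases d) simp_all

lemma data_size_right_le: "data_size (right d) \<le> data_size d"
  by (cases d) simp_all

lemma data_size_filter_le:
  "data_size (list_data (filter P (elems d))) \<le> data_size d"
  by (induction d) simp_all

text \<open>The bind of the list monad, on trees read as lists. Append, filter and the nested
  constructions of the algorithm are instances, so a single running time proof serves them
  all.\<close>

definition bind :: "data \<Rightarrow> (data \<Rightarrow> data) \<Rightarrow> data" where
  "bind d g = list_data (concat (map (\<lambda>x. elems (g x)) (elems d)))"

lemma elems_bind: "elems (bind d g) = concat (map (\<lambda>x. elems (g x)) (elems d))"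
  by (simp add: bind_def)

text \<open>These two trees are also the bits in \<open>nat_data\<close>, so truth values can serve
  as binary digits of colour codes.\<close>

definition truth :: "bool \<Rightarrow> data" where
  "truth P = (if P then Node Leaf Leaf else Leaf)"

lemma truth_eq_Leaf [simp]: "truth P = Leaf \<longleftrightarrow> \<not> P"
  by (simp add: truth_def)

lemma truth_inject [simp]: "truth P = truth Q \<longleftrightarrow> P = Q"
  by (simp add: truth_def)

section \<open>Polynomial bounds\<close>

lemma poly_nat_mono:
  fixes p :: "nat poly"
  shows "m \<le> n \<Longrightarrow> poly p m \<le> poly p n"
  by (induction p) (simp_all add: add_mono mult_mono)

text \<open>The bound takes the tree and not its size, so that it can mention sizes of intermediate
  results such as \<open>data_size (f d)\<close>.\<close>

definition poly_bounded :: "(data \<Rightarrow> nat) \<Rightarrow> bool" where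
  "poly_bounded b \<longleftrightarrow> (\<exists>p. \<forall>d. b d \<le> poly p (data_size d))"

lemma poly_bounded_mono:
  assumes "poly_bounded b" "\<And>d. a d \<le> b d"
  shows "poly_bounded a"
  using assms unfolding poly_bounded_def by (meson le_trans)

lemma poly_bounded_const: "poly_bounded (\<lambda>_. n)"
  unfolding poly_bounded_def by (rule exI[of _ "[:n:]"]) simp

lemma poly_bounded_size: "poly_bounded data_size"
  unfolding poly_bounded_def by (rule exI[of _ "[:0, 1:]"]) simp

lemma poly_bounded_add:
  assumes "poly_bounded a" "poly_bounded b"
  shows "poly_bounded (\<lambda>d. a d + b d)"
proof -
  obtain p q where "\<And>d. a d \<le> poly p (data_size d)" "\<And>d. b d \<le> poly q (data_size d)"
    using assms unfolding poly_bounded_def by blast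
  then have "a d + b d \<le> poly (p + q) (data_size d)" for d
    by (simp add: add_mono)
  then show ?thesis unfolding poly_bounded_def by blast
qed

lemma poly_bounded_mult:
  assumes "poly_bounded a" "poly_bounded b"
  shows "poly_bounded (\<lambda>d. a d * b d)"
proof -
  obtain p q where "\<And>d. a d \<le> poly p (data_size d)" "\<And>d. b d \<le> poly q (data_size d)"
    using assms unfolding poly_bounded_def by blast
  then have "a d * b d \<le> poly (p * q) (data_size d)" for d
    by (simp add: mult_mono)
  then show ?thesis unfolding poly_bounded_def by blast
qed

lemma poly_bounded_poly:
  assumes "poly_bounded a"
  shows "poly_bounded (\<lambda>d. poly q (a d))"
proof -
  obtain p where "\<And>d. a d \<le> poly p (data_size d)"
    using assms unfolding poly_bounded_def by blast
  then have "poly q (a d) \<le> poly (pcompose q p) (data_size d)" for d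
    by (simp add: poly_pcompose poly_nat_mono)
  then show ?thesis unfolding poly_bounded_def by blast
qed

lemmas poly_bounded_intros =
  poly_bounded_const poly_bounded_size poly_bounded_add poly_bounded_mult poly_bounded_poly

section \<open>Functions computable in polynomial time\<close>

definition runs :: "prog \<Rightarrow> store \<Rightarrow> nat \<Rightarrow> store \<Rightarrow> bool" where
  "runs A s n s' \<longleftrightarrow> (\<exists>t\<le>n. exec A s t s')"

lemma runs_mono: "runs A s m s' \<Longrightarrow> m \<le> n \<Longrightarrow> runs A s n s'"
  unfolding runs_def by (meson le_trans)

lemma runs_Assign: "runs (Assign x e) s (1 + cost e s) (s(x := val e s))"
  unfolding runs_def using exec.Assign by blast

lemma runs_Seq: "runs A s m s' \<Longrightarrow> runs B s' n s'' \<Longrightarrow> runs (Seq A B) s (m + n) s''"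
  unfolding runs_def by (meson add_mono exec.Seq)

lemma runs_CondTrue:
  "val e s \<noteq> Leaf \<Longrightarrow> runs A s n s' \<Longrightarrow> runs (Cond e A B) s (1 + cost e s + n) s'"
  unfolding runs_def by (meson add_left_mono exec.CondTrue)

lemma runs_CondFalse:
  "val e s = Leaf \<Longrightarrow> runs B s n s' \<Longrightarrow> runs (Cond e A B) s (1 + cost e s + n) s'"
  unfolding runs_def by (meson add_left_mono exec.CondFalse)

lemma runs_WhileFalse: "val e s = Leaf \<Longrightarrow> runs (While e A) s (1 + cost e s) s"
  unfolding runs_def using exec.WhileFalse by blast

lemma runs_WhileTrue:
  "val e s \<noteq> Leaf \<Longrightarrow> runs A s m s' \<Longrightarrow> runs (While e A) s' n s'' \<Longrightarrow>
    runs (While e A) s (1 + cost e s + m + n) s''"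
  unfolding runs_def by (meson add_left_mono add_mono exec.WhileTrue)

lemma data_size_val_le_cost: "data_size (val e s) \<le> cost e s"
  by (cases e) simp_all

text \<open>An assignment is charged for the size of the value that it stores, so whatever a
  variable newly holds fits into the time spent.\<close>

lemma exec_size: "exec A s t s' \<Longrightarrow> s' x = s x \<or> data_size (s' x) \<le> t"
proof (induction rule: exec.induct)
  case (Assign y e s)
  then show ?case using data_size_val_le_cost[of e s] by simp
qed auto

text \<open>The program must work from every store and leave almost all variables untouched, so that
  programs can be combined.\<close>

definition polytime :: "(data \<Rightarrow> data) \<Rightarrow> bool" where
  "polytime f \<longleftrightarrow> (\<exists>A N b. poly_bounded b \<and>
    (\<forall>s. \<exists>s'. runs A s (b (s 0)) s' \<and> s' 0 = f (s 0) \<and> (\<forall>x\<ge>N. s' x = s x)))"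

lemma polytimeI:
  assumes "poly_bounded b"
    and "\<And>s. \<exists>s'. runs A s (b (s 0)) s' \<and> s' 0 = f (s 0) \<and> (\<forall>x\<ge>N. s' x = s x)"
  shows "polytime f"
  using assms unfolding polytime_def by blast

lemma polytimeE:
  assumes "polytime f"
  obtains A N b where "poly_bounded b"
    "\<And>s. \<exists>s'. runs A s (b (s 0)) s' \<and> s' 0 = f (s 0) \<and> (\<forall>x\<ge>N. s' x = s x)"
  using assms unfolding polytime_def by blast

text \<open>Composition rests on this: the second program runs in time polynomial in the size of the
  intermediate result, which must itself be polynomial in the input.\<close>

lemma polytime_size:
  assumes "polytime f"
  shows "poly_bounded (\<lambda>d. data_size (f d))"
proof -
  obtain A N b where b: "poly_bounded b"
    and A: "\<And>s. \<exists>s'. runs A s (b (s 0)) s' \<and> s' 0 = f (s 0) \<and> (\<forall>x\<ge>N. s' x = s x)"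
    by (rule polytimeE[OF assms]) (rule that)
  have "data_size (f d) \<le> data_size d + b d" for d
    using A[of "\<lambda>_. d"] exec_size[of A "\<lambda>_. d" _ _ 0] unfolding runs_def by fastforce
  then show ?thesis by (rule poly_bounded_mono[rotated]) (intro poly_bounded_intros b)
qed

lemma polytime_Assign:
  assumes "poly_bounded b" "\<And>s. cost e s \<le> b (s 0)" "\<And>s. val e s = f (s 0)"
  shows "polytime f"
proof (rule polytimeI)
  show "poly_bounded (\<lambda>d. 1 + b d)" by (intro poly_bounded_intros assms)
  show "\<exists>s'. runs (Assign 0 e) s (1 + b (s 0)) s' \<and> s' 0 = f (s 0) \<and> (\<forall>x\<ge>1. s' x = s x)" for s
    using runs_mono[OF runs_Assign, of e s "1 + b (s 0)" 0] assms(2,3)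
    by (intro exI[of _ "s(0 := val e s)"]) auto
qed

lemma polytime_id: "polytime (\<lambda>d. d)"
  by (rule polytime_Assign[where e = "Var 0" and b = data_size]) (auto intro: poly_bounded_intros)

lemma polytime_const: "polytime (\<lambda>_. c)"
  by (rule polytime_Assign[where e = "Const c" and b = "\<lambda>_. data_size c"]) (auto intro: poly_bounded_intros)

lemma polytime_comp:
  assumes "polytime g" "polytime f"
  shows "polytime (\<lambda>d. g (f d))"
proof -
  obtain A N b where b: "poly_bounded b"
    and A: "\<And>s. \<exists>s'. runs A s (b (s 0)) s' \<and> s' 0 = f (s 0) \<and> (\<forall>x\<ge>N. s' x = s x)"
    by (rule polytimeE[OF assms(2)]) (rule that)
  obtain B M c where c: "poly_bounded c"
    and B: "\<And>s. \<exists>s'. runs B s (c (s 0)) s' \<and> s' 0 = g (s 0) \<and> (\<forall>x\<ge>M. s' x = s x)"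
    by (rule polytimeE[OF assms(1)]) (rule that)
  obtain q where q: "\<And>d. c d \<le> poly q (data_size d)" using c unfolding poly_bounded_def by blast
  show ?thesis
  proof (rule polytimeI)
    show "poly_bounded (\<lambda>d. b d + poly q (data_size (f d)))"
      by (intro poly_bounded_intros b polytime_size assms)
    fix s :: store
    obtain s1 where s1: "runs A s (b (s 0)) s1" "s1 0 = f (s 0)" "\<forall>x\<ge>N. s1 x = s x"
      using A by blast
    obtain s2 where s2: "runs B s1 (c (s1 0)) s2" "s2 0 = g (s1 0)" "\<forall>x\<ge>M. s2 x = s1 x"
      using B by blast
    show "\<exists>s'. runs (Seq A B) s (b (s 0) + poly q (data_size (f (s 0)))) s' \<and> s' 0 = g (f (s 0)) \<and>
        (\<forall>x\<ge>max N M. s' x = s x)"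
      using runs_Seq[OF s1(1) runs_mono[OF s2(1)], of "poly q (data_size (f (s 0)))"] q[of "f (s 0)"]
        s1 s2 by auto
  qed
qed

lemma polytime_left: "polytime f \<Longrightarrow> polytime (\<lambda>d. left (f d))"
  by (rule polytime_comp[of left], rule polytime_Assign[where e = "Hd (Var 0)" and b = "\<lambda>d. data_size d + data_size d"])
    (auto simp: data_size_left_le intro!: poly_bounded_intros)

lemma polytime_right: "polytime f \<Longrightarrow> polytime (\<lambda>d. right (f d))"
  by (rule polytime_comp[of right], rule polytime_Assign[where e = "Tl (Var 0)" and b = "\<lambda>d. data_size d + data_size d"])
    (auto simp: data_size_right_le intro!: poly_bounded_intros)

lemma polytime_Node:
  assumes "polytime f" "polytime g"
  shows "polytime (\<lambda>d. Node (f d) (g d))"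
proof -
  obtain A N b where b: "poly_bounded b"
    and A: "\<And>s. \<exists>s'. runs A s (b (s 0)) s' \<and> s' 0 = f (s 0) \<and> (\<forall>x\<ge>N. s' x = s x)"
    by (rule polytimeE[OF assms(1)]) (rule that)
  obtain B M c where c: "poly_bounded c"
    and B: "\<And>s. \<exists>s'. runs B s (c (s 0)) s' \<and> s' 0 = g (s 0) \<and> (\<forall>x\<ge>M. s' x = s x)"
    by (rule polytimeE[OF assms(2)]) (rule that)
  \<comment> \<open>Registers from \<open>K\<close> on are untouched by both programs:
    \<open>K\<close> saves the input and \<open>Suc K\<close> the first result. The successor keeps
    \<open>K\<close> apart from variable 0.\<close>
  define K where "K = Suc (max N M)"
  let ?P = "Seq (Assign K (Var 0)) (Seq A (Seq (Assign (Suc K) (Var 0)) (Seq (Assign 0 (Var K))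
    (Seq B (Assign 0 (Join (Var (Suc K)) (Var 0)))))))"
  let ?b = "\<lambda>d. (1 + data_size d) + (b d + ((1 + data_size (f d)) + ((1 + data_size d) +
    (c d + (2 + data_size (f d) + data_size (f d) + data_size (g d) + data_size (g d))))))"
  show ?thesis
  proof (rule polytimeI)
    show "poly_bounded ?b"
      by (intro poly_bounded_intros b c polytime_size assms)
    fix s :: store
    let ?s0 = "s(K := s 0)"
    obtain s1 where s1: "runs A ?s0 (b (s 0)) s1" "s1 0 = f (s 0)" "\<forall>x\<ge>N. s1 x = ?s0 x"
      using A[of ?s0] by (auto simp: K_def)
    let ?s2 = "s1(Suc K := s1 0)"
    let ?s3 = "?s2(0 := ?s2 K)"
    have s3: "?s3 0 = s 0" using s1 by (auto simp: K_def)
    obtain s4 where s4: "runs B ?s3 (c (s 0)) s4" "s4 0 = g (s 0)" "\<forall>x\<ge>M. s4 x = ?s3 x"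
      using B[of ?s3] s3 by auto
    let ?s5 = "s4(0 := Node (s4 (Suc K)) (s4 0))"
    have s4K: "s4 (Suc K) = f (s 0)" using s4 s1 by (auto simp: K_def)
    have "runs ?P s (?b (s 0)) ?s5"
    proof (intro runs_Seq)
      show "runs (Assign K (Var 0)) s (1 + data_size (s 0)) ?s0"
        using runs_Assign[of K "Var 0" s] by simp
      show "runs A ?s0 (b (s 0)) s1" by fact
      show "runs (Assign (Suc K) (Var 0)) s1 (1 + data_size (f (s 0))) ?s2"
        using runs_Assign[of "Suc K" "Var 0" s1] s1 by simp
      show "runs (Assign 0 (Var K)) ?s2 (1 + data_size (s 0)) ?s3"
        using runs_Assign[of 0 "Var K" ?s2] s1 by (simp add: K_def)
      show "runs B ?s3 (c (s 0)) s4" by fact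
      show "runs (Assign 0 (Join (Var (Suc K)) (Var 0))) s4
        (2 + data_size (f (s 0)) + data_size (f (s 0)) + data_size (g (s 0)) + data_size (g (s 0))) ?s5"
        using runs_Assign[of 0 "Join (Var (Suc K)) (Var 0)" s4] s4 s4K by (simp add: algebra_simps)
    qed
    moreover have "?s5 0 = Node (f (s 0)) (g (s 0))" using s4 s4K by simp
    moreover have "\<forall>x\<ge>Suc (Suc K). ?s5 x = s x" using s4(3) s1(3) by (auto simp: K_def)
    ultimately show "\<exists>s'. runs ?P s (?b (s 0)) s' \<and> s' 0 = Node (f (s 0)) (g (s 0)) \<and>
        (\<forall>x\<ge>Suc (Suc K). s' x = s x)" by blast
  qed
qed

lemma polytime_if_nonLeaf:
  assumes "polytime f" "polytime g" "polytime h"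
  shows "polytime (\<lambda>d. if f d \<noteq> Leaf then g d else h d)"
proof -
  obtain A N b where b: "poly_bounded b"
    and A: "\<And>s. \<exists>s'. runs A s (b (s 0)) s' \<and> s' 0 = f (s 0) \<and> (\<forall>x\<ge>N. s' x = s x)"
    by (rule polytimeE[OF assms(1)]) (rule that)
  obtain B M c where c: "poly_bounded c"
    and B: "\<And>s. \<exists>s'. runs B s (c (s 0)) s' \<and> s' 0 = g (s 0) \<and> (\<forall>x\<ge>M. s' x = s x)"
    by (rule polytimeE[OF assms(2)]) (rule that)
  obtain C L e where e: "poly_bounded e"
    and C: "\<And>s. \<exists>s'. runs C s (e (s 0)) s' \<and> s' 0 = h (s 0) \<and> (\<forall>x\<ge>L. s' x = s x)"
    by (rule polytimeE[OF assms(3)]) (rule that)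
  \<comment> \<open>The test overwrites variable 0, so each branch begins by restoring the input
    from \<open>K\<close>.\<close>
  define K where "K = Suc (max N (max M L))"
  let ?B = "Seq (Assign 0 (Var K)) B" and ?C = "Seq (Assign 0 (Var K)) C"
  let ?P = "Seq (Assign K (Var 0)) (Seq A (Cond (Var 0) ?B ?C))"
  let ?b = "\<lambda>d. (1 + data_size d) + (b d + (1 + data_size (f d) + ((1 + data_size d) + (c d + e d))))"
  show ?thesis
  proof (rule polytimeI)
    show "poly_bounded ?b"
      by (intro poly_bounded_intros b c e polytime_size assms)
    fix s :: store
    let ?s0 = "s(K := s 0)"
    obtain s1 where s1: "runs A ?s0 (b (s 0)) s1" "s1 0 = f (s 0)" "\<forall>x\<ge>N. s1 x = ?s0 x"
      using A[of ?s0] by (auto simp: K_def)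
    let ?s2 = "s1(0 := s1 K)"
    have s2: "?s2 0 = s 0" using s1 by (auto simp: K_def)
    have asg: "runs (Assign 0 (Var K)) s1 (1 + data_size (s 0)) ?s2"
      using runs_Assign[of 0 "Var K" s1] s1 by (simp add: K_def)
    have "\<exists>s3. runs (Cond (Var 0) ?B ?C) s1 (1 + data_size (f (s 0)) + ((1 + data_size (s 0)) + (c (s 0) + e (s 0)))) s3 \<and>
      s3 0 = (if f (s 0) \<noteq> Leaf then g (s 0) else h (s 0)) \<and> (\<forall>x\<ge>K. s3 x = s1 x)"
    proof (cases "f (s 0) = Leaf")
      case False
      obtain s3 where s3: "runs B ?s2 (c (s 0)) s3" "s3 0 = g (s 0)" "\<forall>x\<ge>M. s3 x = ?s2 x"
        using B[of ?s2] s2 by auto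
      have "runs ?B s1 ((1 + data_size (s 0)) + (c (s 0) + e (s 0))) s3"
        by (rule runs_mono[OF runs_Seq[OF asg s3(1)]]) simp
      from runs_CondTrue[OF _ this, of "Var 0" ?C] False s1(2) s3 show ?thesis
        by (intro exI[of _ s3]) (auto simp: K_def)
    next
      case True
      obtain s3 where s3: "runs C ?s2 (e (s 0)) s3" "s3 0 = h (s 0)" "\<forall>x\<ge>L. s3 x = ?s2 x"
        using C[of ?s2] s2 by auto
      have "runs ?C s1 ((1 + data_size (s 0)) + (c (s 0) + e (s 0))) s3"
        by (rule runs_mono[OF runs_Seq[OF asg s3(1)]]) simp
      from runs_CondFalse[OF _ this, of "Var 0" ?B] True s1(2) s3 show ?thesis
        by (intro exI[of _ s3]) (auto simp: K_def)
    qed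
    then obtain s3 where s3: "runs (Cond (Var 0) ?B ?C) s1 (1 + data_size (f (s 0)) + ((1 + data_size (s 0)) + (c (s 0) + e (s 0)))) s3"
      "s3 0 = (if f (s 0) \<noteq> Leaf then g (s 0) else h (s 0))" "\<forall>x\<ge>K. s3 x = s1 x" by blast
    have "runs (Assign K (Var 0)) s (1 + data_size (s 0)) ?s0"
      using runs_Assign[of K "Var 0" s] by simp
    from runs_Seq[OF this runs_Seq[OF s1(1) s3(1)]] s3(2,3) s1(3)
    show "\<exists>s'. runs ?P s (?b (s 0)) s' \<and> s' 0 = (if f (s 0) \<noteq> Leaf then g (s 0) else h (s 0)) \<and>
        (\<forall>x\<ge>Suc K. s' x = s x)" by (intro exI[of _ s3]) (auto simp: K_def)
  qed
qed

text \<open>A loop keeps the input, the remaining list and the accumulator in three fresh registers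
  and packs them into a triple for the program of \<open>g\<close>. A polynomial-time step alone
  does not suffice, since iterating it may double the accumulator each time; hence
  \<open>growth\<close> bounds the accumulator after every prefix.\<close>

lemma polytime_fold:
  assumes xs: "polytime xs" and s0: "polytime s0"
    and g: "polytime (\<lambda>t. g (left t) (left (right t)) (right (right t)))"
    and growth: "\<And>d ys zs. elems (xs d) = ys @ zs \<Longrightarrow> data_size (fold (g d) ys (s0 d)) \<le> B d"
    and B: "poly_bounded B"
  shows "polytime (\<lambda>d. fold (g d) (elems (xs d)) (s0 d))"
proof -
  obtain A1 N1 b1 where b1: "poly_bounded b1"
    and A1: "\<And>s. \<exists>s'. runs A1 s (b1 (s 0)) s' \<and> s' 0 = xs (s 0) \<and> (\<forall>x\<ge>N1. s' x = s x)"
    by (rule polytimeE[OF xs]) (rule that)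
  obtain A2 N2 b2 where b2: "poly_bounded b2"
    and A2: "\<And>s. \<exists>s'. runs A2 s (b2 (s 0)) s' \<and> s' 0 = s0 (s 0) \<and> (\<forall>x\<ge>N2. s' x = s x)"
    by (rule polytimeE[OF s0]) (rule that)
  obtain A3 N3 b3 where b3: "poly_bounded b3"
    and A3: "\<And>s. \<exists>s'. runs A3 s (b3 (s 0)) s' \<and>
      s' 0 = g (left (s 0)) (left (right (s 0))) (right (right (s 0))) \<and> (\<forall>x\<ge>N3. s' x = s x)"
    by (rule polytimeE[OF g]) (rule that)
  obtain q where q: "\<And>d. b3 d \<le> poly q (data_size d)" using b3 unfolding poly_bounded_def by blast
  define K where "K = Suc (max N1 (max N2 N3))"
  let ?body = "Seq (Assign 0 (Join (Var K) (Join (Hd (Var (K+1))) (Var (K+2)))))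
    (Seq A3 (Seq (Assign (K+2) (Var 0)) (Assign (K+1) (Tl (Var (K+1))))))"
  let ?W = "While (Var (K+1)) ?body"
  \<comment> \<open>\<open>?n d\<close> bounds the size of the triple. In \<open>?T d\<close>, the
    cost of a round, eight multiples pay for the assignments of the body, two for the guard, and the
    polynomial for the program of \<open>g\<close>.\<close>
  let ?n = "\<lambda>d. 2 + data_size d + data_size (xs d) + B d"
  let ?T = "\<lambda>d. 10 * ?n d + poly q (?n d)"
  let ?P = "Seq (Assign K (Var 0)) (Seq A1 (Seq (Assign (K+1) (Var 0)) (Seq (Assign 0 (Var K))
    (Seq A2 (Seq (Assign (K+2) (Var 0)) (Seq ?W (Assign 0 (Var (K+2)))))))))"
  let ?b = "\<lambda>d. (1 + data_size d) + (b1 d + ((1 + data_size (xs d)) + ((1 + data_size d) + (b2 d +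
    ((1 + data_size (s0 d)) + ((data_size (xs d) * ?T d + 2) + (1 + B d)))))))"
  have body: "\<exists>s'. runs ?body s (8 * ?n d + poly q (?n d)) s' \<and> s' K = d \<and> s' (K+1) = z \<and>
      s' (K+2) = g d x (fold (g d) ys (s0 d)) \<and> (\<forall>x\<ge>K+3. s' x = s x)"
    if "s K = d" "s (K+1) = Node x z" "s (K+2) = fold (g d) ys (s0 d)"
      "elems (xs d) = ys @ x # elems z" for s d ys x z
  proof -
    let ?t = "Node d (Node x (s (K+2)))"
    let ?s1 = "s(0 := ?t)"
    obtain s2 where s2: "runs A3 ?s1 (b3 ?t) s2" "s2 0 = g d x (s (K+2))" "\<forall>x\<ge>N3. s2 x = ?s1 x"
      using A3[of ?s1] by auto
    let ?s3 = "s2(K+2 := s2 0)"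
    let ?s4 = "?s3(K+1 := right (?s3 (K+1)))"
    have s2K: "s2 (K+1) = Node x z" using s2 that by (simp add: K_def)
    have "data_size (g d x (s (K+2))) \<le> B d"
      using growth[of d "ys @ [x]" "elems z"] that by simp
    moreover have "data_size (s (K+2)) \<le> B d"
      using growth[of d ys "x # elems z"] that by simp
    moreover have "data_size z + data_size x < data_size (xs d)"
    proof -
      have "data_size (xs d) = 1 + (\<Sum>y\<leftarrow>ys @ x # elems z. 1 + data_size y)"
        by (subst data_size_elems) (simp add: that)
      then show ?thesis by (simp add: data_size_elems[of z])
    qed
    ultimately have sz: "data_size ?t \<le> ?n d" "data_size (g d x (s (K+2))) \<le> B d"
      "data_size z + data_size x < data_size (xs d)" "data_size (s (K+2)) \<le> B d" by simp_all
    have "runs ?body s ((6 * ?n d) + (poly q (?n d) + ((1 + B d) + (1 + 2 * data_size (xs d))))) ?s4"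
    proof (intro runs_Seq)
      have "runs (Assign 0 (Join (Var K) (Join (Hd (Var (K+1))) (Var (K+2))))) s
        (1 + cost (Join (Var K) (Join (Hd (Var (K+1))) (Var (K+2)))) s) ?s1"
        using runs_Assign[of 0 "Join (Var K) (Join (Hd (Var (K+1))) (Var (K+2)))" s] that by simp
      then show "runs (Assign 0 (Join (Var K) (Join (Hd (Var (K+1))) (Var (K+2))))) s (6 * ?n d) ?s1"
        by (rule runs_mono) (use that sz in simp)
      show "runs A3 ?s1 (poly q (?n d)) s2"
        by (rule runs_mono[OF s2(1)]) (use q[of ?t] poly_nat_mono[OF sz(1), of q] in simp)
      show "runs (Assign (K+2) (Var 0)) s2 (1 + B d) ?s3"
        using runs_mono[OF runs_Assign[of "K+2" "Var 0" s2], of "1 + B d"] s2 sz by simp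
      show "runs (Assign (K+1) (Tl (Var (K+1)))) ?s3 (1 + 2 * data_size (xs d)) ?s4"
      proof (rule runs_mono)
        show "runs (Assign (K+1) (Tl (Var (K+1)))) ?s3 (1 + cost (Tl (Var (K+1))) ?s3) ?s4"
          using runs_Assign[of "K+1" "Tl (Var (K+1))" ?s3] by (simp only: val.simps)
        have "?s3 (K+1) = Node x z" using s2K by simp
        then show "1 + cost (Tl (Var (K+1))) ?s3 \<le> 1 + 2 * data_size (xs d)"
          by (simp del: fun_upd_apply add: fun_upd_same) (use sz(3) in linarith)
      qed
    qed
    then have "runs ?body s (8 * ?n d + poly q (?n d)) ?s4" by (rule runs_mono) simp
    moreover have "?s4 K = d" "?s4 (K+1) = z" "?s4 (K+2) = g d x (fold (g d) ys (s0 d))"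
      "\<forall>x\<ge>K+3. ?s4 x = s x"
      subgoal using s2(3) that(1) by (simp add: K_def)
      subgoal using s2K by simp
      subgoal using s2(2) that(3) by simp
      subgoal using s2(3) by (simp add: K_def)
      done
    ultimately show ?thesis by blast
  qed
  \<comment> \<open>\<open>ys\<close> is the part already consumed. The additional 2 is the cost of
    the last guard, which reads \<open>Leaf\<close>.\<close>
  have loop: "\<exists>s'. runs ?W s (length zs * ?T d + 2) s' \<and>
      s' (K+2) = fold (g d) (ys @ zs) (s0 d) \<and> (\<forall>x\<ge>K+3. s' x = s x)"
    if "s K = d" "s (K+1) = list_data zs" "s (K+2) = fold (g d) ys (s0 d)" "elems (xs d) = ys @ zs"
    for s d ys zs
    using that
  proof (induction zs arbitrary: ys s)
    case Nil
    then show ?case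
      using runs_WhileFalse[of "Var (K+1)" s ?body]
      by (intro exI[of _ s]) simp
  next
    case (Cons x zs)
    obtain s1 where s1: "runs ?body s (8 * ?n d + poly q (?n d)) s1" "s1 K = d" "s1 (K+1) = list_data zs"
       "s1 (K+2) = g d x (fold (g d) ys (s0 d))" "\<forall>x\<ge>K+3. s1 x = s x"
      using body[of s d x "list_data zs" ys] Cons.prems by auto
    have step: "a \<le> b \<Longrightarrow> a + (n * b + 2) \<le> Suc n * b + 2" for a b n :: nat by simp
    have "\<exists>s'. runs ?W s1 (length zs * ?T d + 2) s' \<and>
        s' (K+2) = fold (g d) ((ys @ [x]) @ zs) (s0 d) \<and> (\<forall>x\<ge>K+3. s' x = s1 x)"
      by (rule Cons.IH) (simp_all add: s1 Cons.prems(4) del: One_nat_def add_2_eq_Suc')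
    then obtain s2 where s2: "runs ?W s1 (length zs * ?T d + 2) s2"
      "s2 (K+2) = fold (g d) (ys @ x # zs) (s0 d)" "\<forall>x\<ge>K+3. s2 x = s1 x" by auto
    have "data_size (list_data (x # zs)) \<le> data_size (xs d)"
      by (simp add: data_size_elems[of "xs d"] Cons.prems(4) data_size_list_data)
    then have "1 + cost (Var (K+1)) s + (8 * ?n d + poly q (?n d)) \<le> ?T d"
      unfolding cost.simps val.simps Cons.prems(2) by (simp del: list_data.simps data_size.simps)
    then have le: "1 + cost (Var (K+1)) s + (8 * ?n d + poly q (?n d)) + (length zs * ?T d + 2)
        \<le> length (x # zs) * ?T d + 2"
      using step[of _ _ "length zs"] by (simp only: length_Cons)
    have "val (Var (K+1)) s \<noteq> Leaf" using Cons.prems(2) by simp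
    from runs_mono[OF runs_WhileTrue[OF this s1(1) s2(1)] le] s2(2,3) s1(5) show ?case
      by (intro exI[of _ s2]) simp
  qed
  show ?thesis
  proof (rule polytimeI)
    show "poly_bounded ?b"
      by (intro poly_bounded_intros b1 b2 B polytime_size xs s0)
    fix s :: store
    let ?d = "s 0"
    let ?s1 = "s(K := ?d)"
    obtain s2 where s2: "runs A1 ?s1 (b1 ?d) s2" "s2 0 = xs ?d" "\<forall>x\<ge>N1. s2 x = ?s1 x"
      using A1[of ?s1] by (auto simp: K_def)
    let ?s3 = "s2(K+1 := s2 0)"
    let ?s4 = "?s3(0 := ?s3 K)"
    have s4: "?s4 0 = ?d" using s2 by (simp add: K_def)
    obtain s5 where s5: "runs A2 ?s4 (b2 ?d) s5" "s5 0 = s0 ?d" "\<forall>x\<ge>N2. s5 x = ?s4 x"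
      using A2[of ?s4] s4 by auto
    let ?s6 = "s5(K+2 := s5 0)"
    have "?s6 K = ?d" "?s6 (K+1) = list_data (elems (xs ?d))" "?s6 (K+2) = fold (g ?d) [] (s0 ?d)"
      using s5 s2 by (auto simp: K_def)
    then have "\<exists>s'. runs ?W ?s6 (length (elems (xs ?d)) * ?T ?d + 2) s' \<and>
        s' (K+2) = fold (g ?d) ([] @ elems (xs ?d)) (s0 ?d) \<and> (\<forall>x\<ge>K+3. s' x = ?s6 x)"
      by (rule loop) simp
    then obtain s7 where s7: "runs ?W ?s6 (length (elems (xs ?d)) * ?T ?d + 2) s7"
      "s7 (K+2) = fold (g ?d) (elems (xs ?d)) (s0 ?d)" "\<forall>x\<ge>K+3. s7 x = ?s6 x"
      unfolding append_Nil by blast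
    let ?s8 = "s7(0 := s7 (K+2))"
    have "runs ?P s (?b ?d) ?s8"
    proof (intro runs_Seq)
      show "runs (Assign K (Var 0)) s (1 + data_size ?d) ?s1"
        using runs_Assign[of K "Var 0" s] by simp
      show "runs A1 ?s1 (b1 ?d) s2" by fact
      show "runs (Assign (K+1) (Var 0)) s2 (1 + data_size (xs ?d)) ?s3"
        using runs_Assign[of "K+1" "Var 0" s2] s2 by simp
      show "runs (Assign 0 (Var K)) ?s3 (1 + data_size ?d) ?s4"
        using runs_Assign[of 0 "Var K" ?s3] s4 by simp
      show "runs A2 ?s4 (b2 ?d) s5" by fact
      show "runs (Assign (K+2) (Var 0)) s5 (1 + data_size (s0 ?d)) ?s6"
        using runs_Assign[of "K+2" "Var 0" s5] s5 by simp
      show "runs ?W ?s6 (data_size (xs ?d) * ?T ?d + 2) s7"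
      proof (rule runs_mono[OF s7(1)])
        have "length (elems (xs ?d)) \<le> data_size (xs ?d)"
          using length_elems_less[of "xs ?d"] by simp
        then show "length (elems (xs ?d)) * ?T ?d + 2 \<le> data_size (xs ?d) * ?T ?d + 2"
          by (rule add_right_mono[OF mult_right_mono]) (rule le0)
      qed
      show "runs (Assign 0 (Var (K+2))) s7 (1 + B ?d) ?s8"
        using runs_mono[OF runs_Assign[of 0 "Var (K+2)" s7], of "1 + B ?d"] s7(2)
          growth[of ?d "elems (xs ?d)" "[]"] by simp
    qed
    moreover have "\<forall>x\<ge>K+3. ?s8 x = s x" using s7(3) s5(3) s2(3) by (auto simp: K_def)
    ultimately show "\<exists>s'. runs ?P s (?b (s 0)) s' \<and> s' 0 = fold (g (s 0)) (elems (xs (s 0))) (s0 (s 0)) \<and>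
        (\<forall>x\<ge>K+3. s' x = s x)" using s7(2) by (intro exI[of _ ?s8]) simp
  qed
qed

section \<open>Predicates and list operations in polynomial time\<close>

definition polytime_pred :: "(data \<Rightarrow> bool) \<Rightarrow> bool" where
  "polytime_pred P \<longleftrightarrow> polytime (\<lambda>d. truth (P d))"

lemma polytime_truth: "polytime_pred P \<Longrightarrow> polytime (\<lambda>d. truth (P d))"
  by (simp add: polytime_pred_def)

lemma polytime_if:
  "polytime_pred P \<Longrightarrow> polytime f \<Longrightarrow> polytime g \<Longrightarrow> polytime (\<lambda>d. if P d then f d else g d)"
  using polytime_if_nonLeaf[of "\<lambda>d. truth (P d)" f g] by (simp add: polytime_pred_def)

lemma polytime_pred_eq:
  assumes "polytime f" "polytime g"
  shows "polytime_pred (\<lambda>d. f d = g d)"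
proof -
  have "polytime (\<lambda>d. truth (left d = right d))"
  proof (rule polytime_Assign[where e = "Equal (Hd (Var 0)) (Tl (Var 0))" and b = "\<lambda>d. 4 * data_size d + 3"])
    show "cost (Equal (Hd (Var 0)) (Tl (Var 0))) s \<le> 4 * data_size (s 0) + 3" for s
      using data_size_left_le[of "s 0"] data_size_right_le[of "s 0"] by simp
  qed (auto simp: truth_def intro!: poly_bounded_intros)
  from polytime_comp[OF this polytime_Node[OF assms]] show ?thesis
    by (simp add: polytime_pred_def)
qed

lemma polytime_pred_not:
  assumes "polytime_pred P"
  shows "polytime_pred (\<lambda>d. \<not> P d)"
proof -
  have "truth (\<not> P d) = (if P d then truth False else truth True)" for d by simp
  with polytime_if[OF assms polytime_const[of "truth False"] polytime_const[of "truth True"]]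
  show ?thesis by (simp add: polytime_pred_def)
qed

lemma polytime_pred_conj:
  assumes "polytime_pred P" "polytime_pred Q"
  shows "polytime_pred (\<lambda>d. P d \<and> Q d)"
proof -
  have "truth (P d \<and> Q d) = (if P d then truth (Q d) else truth False)" for d by simp
  with polytime_if[OF assms(1) polytime_truth[OF assms(2)] polytime_const[of "truth False"]]
  show ?thesis by (simp add: polytime_pred_def)
qed

lemma polytime_pred_disj:
  "polytime_pred P \<Longrightarrow> polytime_pred Q \<Longrightarrow> polytime_pred (\<lambda>d. P d \<or> Q d)"
  using polytime_pred_not[OF polytime_pred_conj[OF polytime_pred_not polytime_pred_not], of P Q] by simp

lemma data_size_fold_Node: "data_size (fold Node ys s) = data_size s + (\<Sum>y\<leftarrow>ys. 1 + data_size y)"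
  by (induction ys arbitrary: s) simp_all

lemma fold_Node: "fold Node ys s = list_data (rev ys @ elems s)"
  by (induction ys arbitrary: s) simp_all

text \<open>Pushing the entries of one list onto another reverses them; with \<open>Leaf\<close> as
  the start this is list reversal.\<close>

lemma polytime_fold_Node:
  assumes "polytime xs" "polytime s0"
  shows "polytime (\<lambda>d. fold Node (elems (xs d)) (s0 d))"
proof (rule polytime_fold[where B = "\<lambda>d. data_size (s0 d) + data_size (xs d)"])
  show "polytime (\<lambda>t. Node (left (right t)) (right (right t)))"
    by (intro polytime_Node polytime_left polytime_right polytime_id)
  show "poly_bounded (\<lambda>d. data_size (s0 d) + data_size (xs d))"
    by (intro poly_bounded_intros polytime_size assms)
  show "data_size (fold Node ys (s0 d)) \<le> data_size (s0 d) + data_size (xs d)"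
    if "elems (xs d) = ys @ zs" for d ys zs
    using that by (simp add: data_size_fold_Node data_size_elems[of "xs d"])
qed fact+

text \<open>The outputs are pushed onto one accumulator, which comes out backwards and is reversed
  at the end. There are fewer outputs than \<open>data_size (xs d)\<close>, each of size polynomial
  in \<open>d\<close> and one entry, so the accumulator stays polynomial.\<close>

lemma polytime_bind:
  assumes xs: "polytime xs" and g: "polytime (\<lambda>t. g (left t) (right t))"
  shows "polytime (\<lambda>d. bind (xs d) (g d))"
proof -
  obtain q where q: "data_size (g (left t) (right t)) \<le> poly q (data_size t)" for t
    using polytime_size[OF g] unfolding poly_bounded_def by blast
  let ?c = "\<lambda>d. poly q (1 + data_size d + data_size (xs d))"
  let ?F = "\<lambda>d ys. fold (\<lambda>x. fold Node (elems (g d x))) ys Leaf"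
  have F: "?F d ys = list_data (rev (concat (map (\<lambda>x. elems (g d x)) ys)))" for d ys
    by (induction ys rule: rev_induct) (simp_all add: fold_Node)
  have size_F: "data_size (?F d ys) \<le> 1 + length ys * ?c d" if "set ys \<subseteq> set (elems (xs d))" for d ys
    using that
  proof (induction ys rule: rev_induct)
    \<comment> \<open>Pushing the entries of \<open>g d y\<close> adds one less than its size,
      because its final \<open>Leaf\<close> is not copied; so each round adds at most
      \<open>?c d\<close>.\<close>
    case (snoc y ys)
    have "data_size (g d y) \<le> poly q (data_size (Node d y))" using q[of "Node d y"] by simp
    also have "\<dots> \<le> ?c d"
      using snoc.prems data_size_elem_less[of y "xs d"] by (intro poly_nat_mono) simp
    finally have "data_size (g d y) \<le> ?c d" .
    with snoc show ?case by (simp add: data_size_fold_Node data_size_elems[of "g d y"])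
  qed simp
  have "polytime (\<lambda>d. ?F d (elems (xs d)))"
  proof (rule polytime_fold[where B = "\<lambda>d. 1 + data_size (xs d) * ?c d"])
    show "polytime (\<lambda>t. fold Node (elems (g (left t) (left (right t)))) (right (right t)))"
      using polytime_comp[OF g, of "\<lambda>t. Node (left t) (left (right t))"]
      by (intro polytime_fold_Node) (simp_all add: polytime_Node polytime_left polytime_right polytime_id)
    show "poly_bounded (\<lambda>d. 1 + data_size (xs d) * ?c d)"
      by (intro poly_bounded_intros polytime_size xs)
    fix d ys zs assume *: "elems (xs d) = ys @ zs"
    then have "length ys \<le> data_size (xs d)"
      using length_elems_less[of "xs d"] by simp
    then have "length ys * ?c d \<le> data_size (xs d) * ?c d" by (rule mult_right_mono) simp
    moreover have "data_size (?F d ys) \<le> 1 + length ys * ?c d" by (rule size_F) (simp add: *)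
    ultimately show "data_size (?F d ys) \<le> 1 + data_size (xs d) * ?c d" by linarith
  qed (fact xs, rule polytime_const)
  from polytime_fold_Node[OF this polytime_const[of Leaf]] show ?thesis
    by (simp add: fold_Node F bind_def)
qed

text \<open>Concatenation as the flattening of a two-element list, which makes it an instance of
  \<open>bind\<close>.\<close>

definition app :: "data \<Rightarrow> data \<Rightarrow> data" where
  "app a b = bind (Node a (Node b Leaf)) (\<lambda>x. x)"

lemma elems_app [simp]: "elems (app a b) = elems a @ elems b"
  by (simp add: app_def elems_bind)

definition keep :: "(data \<Rightarrow> bool) \<Rightarrow> data \<Rightarrow> data" where
  "keep P d = bind d (\<lambda>x. if P x then Node x Leaf else Leaf)"

lemma elems_keep [simp]: "elems (keep P d) = filter P (elems d)"
proof -
  have "concat (map (\<lambda>x. elems (if P x then Node x Leaf else Leaf)) xs) = filter P xs" for xs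
    by (induction xs) simp_all
  then show ?thesis by (simp add: keep_def elems_bind)
qed

lemma polytime_app: "polytime f \<Longrightarrow> polytime g \<Longrightarrow> polytime (\<lambda>d. app (f d) (g d))"
  unfolding app_def by (intro polytime_bind polytime_Node polytime_const polytime_right polytime_id)

lemma polytime_keep:
  "polytime_pred (\<lambda>t. P (left t) (right t)) \<Longrightarrow> polytime xs \<Longrightarrow> polytime (\<lambda>d. keep (P d) (xs d))"
  unfolding keep_def
  by (intro polytime_bind polytime_if polytime_Node polytime_const polytime_right polytime_id)

lemma polytime_pred_ex:
  assumes "polytime xs" "polytime_pred (\<lambda>t. P (left t) (right t))"
  shows "polytime_pred (\<lambda>d. \<exists>x\<in>set (elems (xs d)). P d x)"
proof -
  have "(\<exists>x\<in>set (elems (xs d)). P d x) \<longleftrightarrow> \<not> keep (P d) (xs d) = Leaf" for d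
  proof -
    have "keep (P d) (xs d) = list_data (filter (P d) (elems (xs d)))"
      by (metis elems_keep list_data_elems)
    then show ?thesis
      by (cases "filter (P d) (elems (xs d))") (auto simp: filter_empty_conv filter_eq_Cons_iff)
  qed
  then show ?thesis
    using polytime_pred_not[OF polytime_pred_eq[OF polytime_keep polytime_const[of Leaf]]] assms by simp
qed

lemma polytime_pred_all:
  "polytime xs \<Longrightarrow> polytime_pred (\<lambda>t. P (left t) (right t)) \<Longrightarrow>
    polytime_pred (\<lambda>d. \<forall>x\<in>set (elems (xs d)). P d x)"
  using polytime_pred_not[OF polytime_pred_ex[OF _ polytime_pred_not], of xs P] by simp

lemma polytime_pred_member:
  assumes "polytime f" "polytime xs"
  shows "polytime_pred (\<lambda>d. f d \<in> set (elems (xs d)))"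
proof -
  have "polytime (\<lambda>t. f (left t))"
    by (rule polytime_comp[OF assms(1) polytime_left[OF polytime_id]])
  from polytime_pred_ex[OF assms(2) polytime_pred_eq[OF this polytime_right[OF polytime_id]]]
  show ?thesis by (simp add: Bex_def)
qed

lemma fold_right: "fold (\<lambda>_. right) xs s = list_data (drop (length xs) (elems s))"
proof (induction xs arbitrary: s)
  case (Cons x xs)
  then show ?case by (cases s) simp_all
qed simp

text \<open>One entry of \<open>g d\<close> is dropped for each entry of \<open>f d\<close>;
  something is left exactly if \<open>g d\<close> is longer.\<close>

lemma polytime_pred_length_less:
  assumes "polytime f" "polytime g"
  shows "polytime_pred (\<lambda>d. length (elems (f d)) < length (elems (g d)))"
proof -
  have "polytime (\<lambda>d. fold (\<lambda>_. right) (elems (f d)) (g d))"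
  proof (rule polytime_fold[where B = "\<lambda>d. data_size (g d)"])
    have *: "data_size (fold (\<lambda>_. right) ys s) \<le> data_size s" for ys :: "data list" and s
      by (induction ys arbitrary: s) (simp, metis data_size_right_le fold_simps(2) le_trans)
    show "data_size (fold (\<lambda>_. right) ys (g d)) \<le> data_size (g d)" for d and ys :: "data list"
      by (rule *)
  qed (intro assms polytime_right polytime_id polytime_size)+
  from polytime_pred_not[OF polytime_pred_eq[OF this polytime_const[of Leaf]]]
  show ?thesis
    by (simp add: fold_right not_le)
qed

lemmas polytime_intros =
  polytime_id polytime_const polytime_left polytime_right polytime_Node polytime_if polytime_truth
  polytime_bind polytime_app polytime_keep
  polytime_pred_eq polytime_pred_not polytime_pred_conj polytime_pred_disj
  polytime_pred_ex polytime_pred_all polytime_pred_member polytime_pred_length_less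

section \<open>The composition algorithm\<close>

text \<open>The first argument of \<open>subsets\<close> only serves as a bound: doubling stops as soon as there are as
  many sets as it has elements, which keeps the running time polynomial.\<close>

definition subsets :: "data \<Rightarrow> data \<Rightarrow> data" where
  "subsets b d = fold (\<lambda>x V. if length (elems V) < length (elems b)
      then app V (bind V (\<lambda>T. Node (Node x T) Leaf)) else V) (elems d) (Node Leaf Leaf)"

text \<open>Each name extends the preceding one by a bit. Since \<open>left Leaf = Leaf\<close>, the
  first name has length one; the empty word never occurs, which matters for
  \<open>tag_in_range_nat_data\<close>.\<close>

definition names :: "data \<Rightarrow> data" where
  "names d = fold (\<lambda>_ s. Node (Node (truth True) (left s)) s) (elems d) Leaf"

text \<open>Entries are paired with the remaining suffix of the second list, so that \<^const>\<open>Leaf\<close> marks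
  the entries beyond its end.\<close>

definition zips :: "data \<Rightarrow> data \<Rightarrow> data" where
  "zips d e = right (fold (\<lambda>x s. Node (right (left s)) (Node (Node (left s) x) (right s)))
    (elems d) (Node e Leaf))"

section \<open>Running times of the building blocks\<close>

text \<open>A doubling takes place only below \<open>length (elems (b d))\<close>, so the list never
  exceeds twice that length unless it is the initial singleton. Every entry is a reversed
  subsequence of the entries of \<open>f d\<close> and hence no larger than
  \<open>f d\<close>.\<close>

lemma polytime_subsets:
  assumes "polytime b" "polytime f"
  shows "polytime (\<lambda>d. subsets (b d) (f d))"
  unfolding subsets_def
proof (rule polytime_fold[where B = "\<lambda>d. 1 + (2 * data_size (b d) + 1) * (1 + data_size (f d))"])
  show "polytime (\<lambda>t. if length (elems (right (right t))) < length (elems (b (left t)))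
     then app (right (right t)) (bind (right (right t)) (\<lambda>T. Node (Node (left (right t)) T) Leaf))
     else right (right t))"
    by (intro polytime_intros polytime_comp[OF assms(1)])
  show "poly_bounded (\<lambda>d. 1 + (2 * data_size (b d) + 1) * (1 + data_size (f d)))"
    by (intro poly_bounded_intros polytime_size assms)
  fix d ys zs assume *: "elems (f d) = ys @ zs"
  define g where "g = (\<lambda>x V. if length (elems V) < length (elems (b d))
      then app V (bind V (\<lambda>T. Node (Node x T) Leaf)) else V)"
  define V where "V = fold g ys (Node Leaf Leaf)"
  have "length (elems V) \<le> 2 * data_size (b d) + 1 \<and>
      (\<forall>T\<in>set (elems V). data_size T \<le> 1 + (\<Sum>y\<leftarrow>ys. 1 + data_size y))"
    unfolding V_def
  proof (induction ys rule: rev_induct)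
    case (snoc y ys)
    let ?V = "fold g ys (Node Leaf Leaf)"
    have "length (elems (g y ?V)) \<le> 2 * data_size (b d) + 1"
      using snoc length_elems_less[of "b d"]
      by (auto simp: g_def elems_bind comp_def length_concat sum_list_triv)
    moreover have "\<forall>T\<in>set (elems (g y ?V)). data_size T \<le> 1 + (\<Sum>y\<leftarrow>ys @ [y]. 1 + data_size y)"
      using snoc by (auto simp: g_def elems_bind)
    ultimately show ?case by simp
  qed simp
  then have len: "length (elems V) \<le> 2 * data_size (b d) + 1"
    and size: "\<And>T. T \<in> set (elems V) \<Longrightarrow> 1 + data_size T \<le> 1 + data_size (f d)"
    by (auto simp: data_size_elems[of "f d"] *)
  have "data_size V \<le> 1 + length (elems V) * (1 + data_size (f d))"
    using sum_list_mono[of "elems V" "\<lambda>T. 1 + data_size T" "\<lambda>_. 1 + data_size (f d)"] size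
    by (simp add: data_size_elems[of V] sum_list_triv)
  also have "\<dots> \<le> 1 + (2 * data_size (b d) + 1) * (1 + data_size (f d))"
    using len by (intro add_left_mono mult_right_mono) simp_all
  finally show "data_size (fold g ys (Node Leaf Leaf)) \<le>
      1 + (2 * data_size (b d) + 1) * (1 + data_size (f d))" by (simp add: V_def)
qed (intro assms polytime_intros)+

lemma polytime_names:
  assumes "polytime f"
  shows "polytime (\<lambda>d. names (f d))"
  unfolding names_def
\<comment> \<open>A bit of a name takes 4 units, namely a node and \<open>truth True\<close>; so the
  r-th name has size 4r + 1.\<close>
proof (rule polytime_fold[where B = "\<lambda>d. 1 + data_size (f d) * (4 * data_size (f d) + 6)"])
  show "poly_bounded (\<lambda>d. 1 + data_size (f d) * (4 * data_size (f d) + 6))"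
    by (intro poly_bounded_intros polytime_size assms)
  fix d ys zs assume "elems (f d) = ys @ zs"
  then have len: "length ys \<le> data_size (f d)"
    using length_elems_less[of "f d"] by simp
  let ?V = "fold (\<lambda>_ s. Node (Node (truth True) (left s)) s) ys Leaf"
  have "data_size (left ?V) \<le> 4 * length ys + 1 \<and>
    data_size ?V \<le> 1 + length ys * (4 * length ys + 6)"
  proof (induction ys rule: rev_induct)
    case (snoc y ys)
    then show ?case by (simp add: truth_def algebra_simps)
  qed simp
  moreover have "1 + length ys * (4 * length ys + 6) \<le> 1 + data_size (f d) * (4 * data_size (f d) + 6)"
    using len by (intro add_left_mono mult_mono) simp_all
  ultimately show "data_size ?V \<le> 1 + data_size (f d) * (4 * data_size (f d) + 6)" by linarith
qed (intro assms polytime_intros)+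

text \<open>Every entry carries a whole suffix of the second list, so the size is bounded by a
  product and not by a sum.\<close>

lemma polytime_zips:
  assumes "polytime f" "polytime h"
  shows "polytime (\<lambda>d. zips (f d) (h d))"
  unfolding zips_def
proof (rule polytime_right,
    rule polytime_fold[where B = "\<lambda>d. data_size (f d) + (3 + data_size (f d)) * (3 + data_size (h d))"])
  show "poly_bounded (\<lambda>d. data_size (f d) + (3 + data_size (f d)) * (3 + data_size (h d)))"
    by (intro poly_bounded_intros polytime_size assms)
  fix d ys zs assume *: "elems (f d) = ys @ zs"
  let ?s = "fold (\<lambda>x s. Node (right (left s)) (Node (Node (left s) x) (right s))) ys (Node (h d) Leaf)"
  have "data_size (left ?s) \<le> data_size (h d) \<and>
    data_size (right ?s) \<le> 1 + (\<Sum>y\<leftarrow>ys. 1 + data_size y) + length ys * (1 + data_size (h d))"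
  proof (induction ys rule: rev_induct)
    case (snoc y ys)
    let ?s = "fold (\<lambda>x s. Node (right (left s)) (Node (Node (left s) x) (right s))) ys (Node (h d) Leaf)"
    from snoc show ?case using data_size_right_le[of "left ?s"] by simp
  qed simp
  moreover have "data_size ?s \<le> 1 + data_size (left ?s) + data_size (right ?s)"
    by (cases ?s) simp_all
  moreover have "1 + (\<Sum>y\<leftarrow>ys. 1 + data_size y) \<le> data_size (f d)"
    by (simp add: data_size_elems[of "f d"] *)
  moreover have "length ys * (1 + data_size (h d)) \<le> data_size (f d) * (1 + data_size (h d))"
    using * length_elems_less[of "f d"] by (intro mult_right_mono) simp_all
  moreover have "1 + data_size (h d) + data_size (f d) * (1 + data_size (h d)) \<le>
     (3 + data_size (f d)) * (3 + data_size (h d))" by (simp add: algebra_simps)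
  ultimately show "data_size ?s \<le> data_size (f d) + (3 + data_size (f d)) * (3 + data_size (h d))"
    by linarith
qed (intro assms polytime_intros)+

text \<open>Colours of a composed instance are named by unary words \<open>1\<^sup>r\<close> with \<open>r \<ge> 1\<close>; such a word
  followed by further bits is the binary code of a number.  The colour \<open>tag i q b\<close> is named by
  \<open>b 1\<^sup>i 0 1\<^sup>q\<close>.\<close>

definition tag :: "data \<Rightarrow> data \<Rightarrow> bool \<Rightarrow> data" where
  "tag i q b = Node (truth b) (app i (Node Leaf q))"

definition tags :: "data \<Rightarrow> data \<Rightarrow> data \<Rightarrow> data" where
  "tags Q i T = bind Q (\<lambda>q. Node (tag i q (q \<in> set (elems T))) Leaf)"

text \<open>The complement of \<open>tags\<close>, for all switch indices at once: together with the
  \<open>tags\<close> of all switches it exhausts the tag colours exactly if the identifiers agree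
  on \<open>Q\<close>.\<close>

definition cotags :: "data \<Rightarrow> data \<Rightarrow> data" where
  "cotags Q T = bind Q (\<lambda>i. bind Q (\<lambda>q. Node (tag i q (\<not> q \<in> set (elems T))) Leaf))"

text \<open>The instances have unrelated colour sets, so the r-th colour of each becomes the r-th
  name. Names beyond the last colour are padding and belong to every position, so that they are
  always covered.\<close>

definition rename :: "data \<Rightarrow> data \<Rightarrow> data \<Rightarrow> data" where
  "rename Q cs pos = bind (zips Q cs) (\<lambda>z.
    if left z = Leaf \<or> left (left z) \<in> set (elems pos) then Node (right z) Leaf else Leaf)"

definition colors :: "data \<Rightarrow> data" where
  "colors Q = app Q (bind Q (\<lambda>i. bind Q (\<lambda>q. Node (tag i q True) (Node (tag i q False) Leaf))))"

text \<open>In an entry \<open>z\<close> of \<open>Z\<close>, \<open>right z\<close> is an instance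
  and \<open>left (left z)\<close> its identifier. Renaming the empty position \<open>Leaf\<close>
  gives the padding names only, so the hub covers no genuine colour.\<close>

definition hub :: "data \<Rightarrow> data \<Rightarrow> data" where
  "hub Q Z = bind Z (\<lambda>z. Node (app (rename Q (left (right z)) Leaf) (cotags Q (left (left z)))) Leaf)"

text \<open>The comparison \<open>right y = i\<close> selects the switch at the index of
  \<open>i\<close> in \<open>Q\<close>. A missing switch becomes \<open>Node Leaf Leaf\<close>,
  whose only position is empty, and so does no harm; a switch without positions contributes nothing
  and still makes its instance unsolvable.\<close>

definition merged_switch :: "data \<Rightarrow> data \<Rightarrow> data \<Rightarrow> data" where
  "merged_switch Q Z i = bind Z (\<lambda>z. bind (zips Q (right (right z))) (\<lambda>y. if right y = i
    then bind (if left y = Leaf then Node Leaf Leaf else left (left y))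
      (\<lambda>pos. Node (app (rename Q (left (right z)) pos) (tags Q i (left (left z)))) Leaf)
    else Leaf))"

definition combine :: "data \<Rightarrow> data \<Rightarrow> data" where
  "combine Q Z = Node (colors Q) (Node (hub Q Z) (bind Q (\<lambda>i. Node (merged_switch Q Z i) Leaf)))"

text \<open>Dynamic programming over the switches. An entry \<open>T\<close> has to contain the
  colours that remain uncovered and need not equal them, so membership tests replace equality of
  sets.\<close>

definition solvable_by_table :: "data \<Rightarrow> data \<Rightarrow> bool" where
  "solvable_by_table b d \<longleftrightarrow> Leaf \<in> set (elems (fold
    (\<lambda>s St. keep (\<lambda>T. \<exists>R\<in>set (elems St). \<exists>pos\<in>set (elems s). \<forall>x\<in>set (elems R).
        x \<in> set (elems T) \<or> x \<in> set (elems pos)) (subsets b (left d)))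
    (elems (right d)) (Node (left d) Leaf)))"

text \<open>The concatenation merely supplies a list of length p: the colours and switches of the
  first instance. As all parameters equal p, this many names suffice for every instance.\<close>

definition color_names :: "data \<Rightarrow> data" where
  "color_names Is = names (app (left (left Is)) (right (left Is)))"

text \<open>\<open>Node Leaf Leaf\<close> has neither colours nor switches and is a yes-instance;
  \<open>Node Leaf (Node Leaf Leaf)\<close> has one switch without positions, where nothing can be
  chosen.\<close>

definition compose :: "data \<Rightarrow> data" where
  "compose Is = (if length (elems (subsets Is (color_names Is))) < length (elems Is)
    then if \<exists>I\<in>set (elems Is). solvable_by_table Is I then Node Leaf Leaf
      else Node Leaf (Node Leaf Leaf)
    else combine (color_names Is) (zips Is (subsets Is (color_names Is))))"

text \<open>After each round the table is a filtered copy of the list of subsets, so it cannot grow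
  over the rounds; the other summands of the bound pay for the initial table.\<close>

lemma polytime_pred_solvable_by_table:
  assumes "polytime b" "polytime f"
  shows "polytime_pred (\<lambda>d. solvable_by_table (b d) (f d))"
  unfolding solvable_by_table_def
proof (intro polytime_pred_member polytime_const,
    rule polytime_fold[where B = "\<lambda>d. 2 + data_size (f d) + data_size (subsets (b d) (left (f d)))"])
  show "polytime (\<lambda>t. keep (\<lambda>T. \<exists>R\<in>set (elems (right (right t))). \<exists>pos\<in>set (elems (left (right t))).
      \<forall>x\<in>set (elems R). x \<in> set (elems T) \<or> x \<in> set (elems pos))
    (subsets (b (left t)) (left (f (left t)))))"
    by (intro polytime_intros polytime_subsets polytime_comp[OF assms(1)] polytime_comp[OF assms(2)])
  show "poly_bounded (\<lambda>d. 2 + data_size (f d) + data_size (subsets (b d) (left (f d))))"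
    by (intro poly_bounded_intros polytime_size polytime_subsets polytime_left assms)
  fix d and ys zs :: "data list"
  show "data_size (fold (\<lambda>s St. keep (\<lambda>T. \<exists>R\<in>set (elems St). \<exists>pos\<in>set (elems s). \<forall>x\<in>set (elems R).
        x \<in> set (elems T) \<or> x \<in> set (elems pos)) (subsets (b d) (left (f d)))) ys (Node (left (f d)) Leaf))
      \<le> 2 + data_size (f d) + data_size (subsets (b d) (left (f d)))"
  proof (cases ys rule: rev_cases)
    case Nil
    then show ?thesis using data_size_left_le[of "f d"] by simp
  next
    case (snoc us u)
    have "data_size (keep P e) \<le> data_size e" for P e
      by (metis data_size_filter_le elems_keep list_data_elems)
    then have "data_size (keep P e) \<le> n + data_size e" for P e n by (rule trans_le_add2)
    with snoc show ?thesis by (simp only: fold_append fold_simps comp_apply)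
  qed
qed (intro assms polytime_intros)+

lemma polytime_compose: "polytime compose"
  unfolding compose_def combine_def merged_switch_def hub_def colors_def rename_def cotags_def
    tags_def tag_def color_names_def
  by (intro polytime_intros polytime_subsets polytime_names polytime_zips
    polytime_pred_solvable_by_table)

subsection \<open>Subsets, names and indices\<close>

lemma subsets_Leaf [simp]: "subsets b Leaf = Node Leaf Leaf"
  by (simp add: subsets_def)

lemma elems_subsets_snoc:
  "elems (subsets b (list_data (xs @ [x]))) =
    (let V = elems (subsets b (list_data xs)) in
      if length V < length (elems b) then V @ map (Node x) V else V)"
proof -
  have "concat (map (\<lambda>T. [Node x T]) V) = map (Node x) V" for V
    by (induction V) simp_all
  then show ?thesis by (simp add: subsets_def elems_bind Let_def)
qed

lemma subsets_subset:
  "T \<in> set (elems (subsets b (list_data xs))) \<Longrightarrow> set (elems T) \<subseteq> set xs"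
proof (induction xs arbitrary: T rule: rev_induct)
  case (snoc x xs)
  show ?case
  proof
    fix y assume y: "y \<in> set (elems T)"
    consider "T \<in> set (elems (subsets b (list_data xs)))"
      | S where "S \<in> set (elems (subsets b (list_data xs)))" "T = Node x S"
      using snoc.prems by (auto simp: elems_subsets_snoc Let_def split: if_splits)
    then show "y \<in> set (xs @ [x])" using snoc.IH y by cases auto
  qed
qed simp

text \<open>The sets added in a doubling contain the new element \<open>x\<close> and the old ones
  do not, so only sets of the same half can coincide, and there the induction hypothesis applies.
  Thus different positions in the list yield identifiers that differ as sets.\<close>

lemma inj_on_set_subsets:
  "distinct xs \<Longrightarrow> inj_on (\<lambda>T. set (elems T)) (set (elems (subsets b (list_data xs)))) \<and>
    distinct (elems (subsets b (list_data xs)))"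
proof (induction xs rule: rev_induct)
  case (snoc x xs)
  let ?V = "elems (subsets b (list_data xs))"
  have x: "x \<notin> set (elems T)" if "T \<in> set ?V" for T
    using snoc.prems subsets_subset[OF that] by auto
  have IH: "inj_on (\<lambda>T. set (elems T)) (set ?V)" "distinct ?V" using snoc by auto
  have "inj_on (\<lambda>T. set (elems T)) (set (?V @ map (Node x) ?V))"
  proof (rule inj_onI)
    fix S T assume S: "S \<in> set (?V @ map (Node x) ?V)" and T: "T \<in> set (?V @ map (Node x) ?V)"
      and eq: "set (elems S) = set (elems T)"
    have "x \<in> set (elems S) \<longleftrightarrow> x \<in> set (elems T)" using eq by simp
    then consider "S \<in> set ?V" "T \<in> set ?V" | S' T' where "S' \<in> set ?V" "T' \<in> set ?V" "S = Node x S'" "T = Node x T'"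
      using S T x by (cases "S \<in> set ?V"; cases "T \<in> set ?V") auto
    then show "S = T"
    proof cases
      case 1
      then show ?thesis using IH(1) eq by (auto dest: inj_onD)
    next
      case 2
      then have "set (elems S') = set (elems T')" using eq x by (simp add: insert_ident)
      then show ?thesis using 2 IH(1) by (auto dest: inj_onD)
    qed
  qed
  moreover have "distinct (?V @ map (Node x) ?V)"
    using IH(2) x[of "Node x _"] by (auto simp: distinct_map inj_on_def)
  ultimately show ?case using IH by (simp add: elems_subsets_snoc Let_def)
qed simp

text \<open>Lengths never decrease, so a final length below the cap means that every element caused
  a doubling and no subset is missing. Elements are put in front, hence the reversed order.\<close>

lemma filter_in_subsets:
  "length (elems (subsets b (list_data xs))) < length (elems b) \<Longrightarrow>
    list_data (filter P (rev xs)) \<in> set (elems (subsets b (list_data xs)))"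
  by (induction xs rule: rev_induct) (auto simp: elems_subsets_snoc Let_def split: if_splits)

lemma length_subsets:
  "length (elems (subsets b (list_data xs))) =
    ((\<lambda>l. if l < length (elems b) then 2 * l else l) ^^ length xs) 1"
  by (induction xs rule: rev_induct) (auto simp: elems_subsets_snoc Let_def)

text \<open>Transfers the case m > 2^p from \<open>Q\<close> to the instances: the at most p colours
  of an instance yield no more subsets than the p names.\<close>

lemma length_subsets_mono:
  assumes "length xs \<le> length ys"
  shows "length (elems (subsets b (list_data xs))) \<le> length (elems (subsets b (list_data ys)))"
proof -
  let ?f = "\<lambda>l. if l < length (elems b) then 2 * l else l"
  have "(?f ^^ m) 1 \<le> (?f ^^ (m + k)) 1" for m k
  proof (induction k)
    case (Suc k)
    have "l \<le> ?f l" for l by simp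
    from this[of "(?f ^^ (m + k)) 1"] have "(?f ^^ (m + k)) 1 \<le> (?f ^^ (m + Suc k)) 1"
      by (simp only: add_Suc_right funpow.simps comp_apply)
    with Suc show ?case by (rule le_trans)
  qed simp
  from this[of "length xs" "length ys - length xs"] assms show ?thesis
    unfolding length_subsets by simp
qed

definition unary :: "nat \<Rightarrow> data" where
  "unary r = list_data (replicate r (Node Leaf Leaf))"

lemma unary_inject [simp]: "unary m = unary n \<longleftrightarrow> m = n"
  unfolding unary_def by (metis elems_list_data length_replicate)

lemma elems_names: "elems (names d) = map (\<lambda>r. unary (Suc r)) (rev [0..<length (elems d)])"
proof -
  have "fold (\<lambda>_ s. Node (Node (truth True) (left s)) s) xs Leaf =
      list_data (map (\<lambda>r. unary (Suc r)) (rev [0..<length xs]))" for xs :: "data list"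
  proof (induction xs rule: rev_induct)
    case (snoc x xs)
    have "left (list_data (map (\<lambda>r. unary (Suc r)) (rev [0..<length xs]))) = unary (length xs)"
      by (cases "length xs") (simp_all add: unary_def)
    then show ?case using snoc by (simp add: unary_def truth_def)
  qed simp
  then show ?thesis by (simp add: names_def)
qed

lemma length_names [simp]: "length (elems (names d)) = length (elems d)"
  by (simp add: elems_names)

lemma distinct_names: "distinct (elems (names d))"
  unfolding elems_names by (auto simp: distinct_map inj_on_def)

lemma names_unary: "x \<in> set (elems (names d)) \<Longrightarrow> \<exists>r. x = unary (Suc r)"
  by (auto simp: elems_names)

lemma right_list_data: "right (list_data xs) = list_data (tl xs)"
  by (cases xs) simp_all

lemma left_list_data: "xs \<noteq> [] \<Longrightarrow> left (list_data xs) = hd xs"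
  by (cases xs) simp_all

text \<open>The fold collects entries backwards, but all uses depend on membership only.\<close>

lemma set_zips:
  "set (elems (zips d e)) =
    {Node (list_data (drop n (elems e))) (elems d ! n) |n. n < length (elems d)}"
proof -
  let ?s = "\<lambda>xs. fold (\<lambda>x s. Node (right (left s)) (Node (Node (left s) x) (right s))) xs (Node e Leaf)"
  have "left (?s xs) = list_data (drop (length xs) (elems e)) \<and>
    set (elems (right (?s xs))) = {Node (list_data (drop n (elems e))) (xs ! n) |n. n < length xs}" for xs
  proof (induction xs rule: rev_induct)
    case (snoc x xs)
    have "{f n (xs @ [x]) |n. n < length (xs @ [x])} = insert (f (length xs) (xs @ [x])) {f n xs |n. n < length xs}"
      if "\<And>n. n < length xs \<Longrightarrow> f n (xs @ [x]) = f n xs" for f :: "nat \<Rightarrow> data list \<Rightarrow> data"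
      using that by (force simp: less_Suc_eq)
    from this[of "\<lambda>n xs. Node (list_data (drop n (elems e))) (xs ! n)"]
    have *: "{Node (list_data (drop n (elems e))) ((xs @ [x]) ! n) |n. n < length (xs @ [x])} =
      insert (Node (list_data (drop (length xs) (elems e))) x)
        {Node (list_data (drop n (elems e))) (xs ! n) |n. n < length xs}"
      by (simp add: nth_append)
    show ?case unfolding * using snoc
      by (simp add: right_list_data drop_Suc tl_drop)
  qed simp
  then show ?thesis by (simp add: zips_def)
qed

section \<open>Correctness\<close>

text \<open>The set to be covered is separate from the switches so that partial covers, of all
  colours outside a table entry, can be expressed.\<close>

definition coverable :: "data list \<Rightarrow> data set \<Rightarrow> bool" where
  "coverable ss X \<longleftrightarrow> (\<exists>ch :: nat \<Rightarrow> data. (\<forall>n<length ss. ch n \<in> set (elems (ss ! n))) \<and>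
    (\<forall>c\<in>X. \<exists>n<length ss. c \<in> set (elems (ch n))))"

definition solvable :: "data \<Rightarrow> bool" where
  "solvable d \<longleftrightarrow> coverable (elems (right d)) (set (elems (left d)))"

text \<open>The table after the switches \<open>ss\<close> consists of sets \<open>R\<close> such that one choice of positions
  from \<open>ss\<close> covers every colour outside \<open>R\<close>; it contains the set of uncovered colours of each
  choice.\<close>

lemma solvable_by_table_iff:
  assumes "length (elems (subsets b (left d))) < length (elems b)"
  shows "solvable_by_table b d \<longleftrightarrow> solvable d"
proof -
  define cs where "cs = elems (left d)"
  have cs: "left d = list_data cs" by (simp add: cs_def)
  define step where "step = (\<lambda>s St. keep (\<lambda>T. \<exists>R\<in>set (elems St). \<exists>pos\<in>set (elems s). \<forall>x\<in>set (elems R).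
        x \<in> set (elems T) \<or> x \<in> set (elems pos)) (subsets b (left d)))"
  define table where "table = (\<lambda>ss. set (elems (fold step ss (Node (left d) Leaf))))"
  have table_snoc: "T \<in> table (ss @ [s]) \<longleftrightarrow> T \<in> set (elems (subsets b (left d))) \<and>
    (\<exists>R\<in>table ss. \<exists>pos\<in>set (elems s). set (elems R) \<subseteq> set (elems T) \<union> set (elems pos))" for T ss s
    by (auto simp: table_def step_def subset_eq)
  have sound: "R \<in> table ss \<Longrightarrow> coverable ss (set cs - set (elems R))" for R ss
  proof (induction ss arbitrary: R rule: rev_induct)
    case Nil
    then show ?case by (simp add: table_def coverable_def cs)
  next
    case (snoc s ss)
    then obtain R' pos where R': "R' \<in> table ss" "pos \<in> set (elems s)"
      "set (elems R') \<subseteq> set (elems R) \<union> set (elems pos)"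
      by (auto simp: table_snoc)
    then obtain ch where ch: "\<forall>n<length ss. ch n \<in> set (elems (ss ! n))"
      "\<forall>c\<in>set cs - set (elems R'). \<exists>n<length ss. c \<in> set (elems (ch n))"
      using snoc.IH unfolding coverable_def by blast
    let ?ch = "ch(length ss := pos)"
    have "?ch n \<in> set (elems ((ss @ [s]) ! n))" if "n < length (ss @ [s])" for n
      using that ch(1) R'(2) by (auto simp: nth_append less_Suc_eq)
    moreover have "\<exists>n<length (ss @ [s]). c \<in> set (elems (?ch n))" if "c \<in> set cs - set (elems R)" for c
    proof (cases "c \<in> set (elems pos)")
      case True
      then show ?thesis by (intro exI[of _ "length ss"]) simp
    next
      case False
      then have "c \<in> set cs - set (elems R')" using that R'(3) by blast
      then obtain n where "n < length ss" "c \<in> set (elems (ch n))" using ch(2) by blast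
      then show ?thesis by (intro exI[of _ n]) simp
    qed
    ultimately show ?case unfolding coverable_def by blast
  qed
  \<comment> \<open>The entry is determined only as a set: the initial entry \<open>left d\<close>
    lists the colours in an order different from that of \<open>subsets\<close>.\<close>
  have complete: "\<exists>R\<in>table ss. set (elems R) = {c\<in>set cs. \<forall>n<length ss. c \<notin> set (elems (ch n))}"
    if "\<forall>n<length ss. ch n \<in> set (elems (ss ! n))" for ss ch
    using that
  proof (induction ss rule: rev_induct)
    case Nil
    then show ?case by (simp add: table_def cs)
  next
    case (snoc s ss)
    have "ch n \<in> set (elems (ss ! n))" if "n < length ss" for n
      using snoc.prems that by (auto simp: nth_append dest: spec[of _ n])
    with snoc.IH obtain R where R: "R \<in> table ss"
      "set (elems R) = {c\<in>set cs. \<forall>n<length ss. c \<notin> set (elems (ch n))}" by blast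
    have pos: "ch (length ss) \<in> set (elems s)" using snoc.prems by (auto dest: spec[of _ "length ss"])
    \<comment> \<open>The uncovered colours in reverse order, the form in which
      \<open>filter_in_subsets\<close> finds them.\<close>
    let ?T = "list_data (filter (\<lambda>c. \<forall>n<length (ss @ [s]). c \<notin> set (elems (ch n))) (rev cs))"
    have "?T \<in> table (ss @ [s])"
      unfolding table_snoc
    proof
      show "?T \<in> set (elems (subsets b (left d)))"
        using filter_in_subsets[of b cs] assms cs by simp
      show "\<exists>R\<in>table ss. \<exists>pos\<in>set (elems s). set (elems R) \<subseteq> set (elems ?T) \<union> set (elems pos)"
        by (rule bexI[OF _ R(1)], rule bexI[OF _ pos]) (auto simp: R(2) less_Suc_eq)
    qed
    then show ?case by (rule bexI[rotated]) auto
  qed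
  have "solvable_by_table b d \<longleftrightarrow> Leaf \<in> table (elems (right d))"
    by (simp add: solvable_by_table_def table_def step_def)
  also have "\<dots> \<longleftrightarrow> solvable d"
  proof
    assume "Leaf \<in> table (elems (right d))"
    from sound[OF this] show "solvable d" by (simp add: solvable_def cs)
  next
    assume "solvable d"
    then obtain ch where ch: "\<forall>n<length (elems (right d)). ch n \<in> set (elems (elems (right d) ! n))"
      "\<forall>c\<in>set cs. \<exists>n<length (elems (right d)). c \<in> set (elems (ch n))"
      unfolding solvable_def coverable_def cs_def by blast
    have "{c\<in>set cs. \<forall>n<length (elems (right d)). c \<notin> set (elems (ch n))} = {}" using ch(2) by blast
    with complete[OF ch(1)] obtain R where R: "R \<in> table (elems (right d))" "set (elems R) = {}"
      by metis
    then have "R = Leaf" by (cases R) auto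
    with R show "Leaf \<in> table (elems (right d))" by simp
  qed
  finally show ?thesis .
qed

section \<open>Contents of the composed switches and positions\<close>

lemma set_rename:
  "set (elems (rename Q cs pos)) = {elems Q ! r |r. r < length (elems Q) \<and>
    (r < length (elems cs) \<longrightarrow> elems cs ! r \<in> set (elems pos))}" (is "?A = ?B")
proof -
  have hd: "left (list_data (drop r (elems cs))) = elems cs ! r" if "r < length (elems cs)" for r
    using that by (simp add: left_list_data hd_drop_conv_nth)
  have "x \<in> ?A \<longleftrightarrow> (\<exists>r<length (elems Q). (length (elems cs) \<le> r \<or>
      left (list_data (drop r (elems cs))) \<in> set (elems pos)) \<and> x = elems Q ! r)" for x
    unfolding rename_def elems_bind set_concat set_map set_zips by auto
  also have "\<dots> x \<longleftrightarrow> x \<in> ?B" for x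
    using hd by (auto simp: not_less) (metis not_le)+
  finally show ?thesis by blast
qed

lemma set_tags: "set (elems (tags Q i T)) = {tag i q (q \<in> set (elems T)) |q. q \<in> set (elems Q)}"
  by (auto simp: tags_def elems_bind)

lemma set_cotags:
  "set (elems (cotags Q T)) =
    {tag i q (q \<notin> set (elems T)) |i q. i \<in> set (elems Q) \<and> q \<in> set (elems Q)}"
  by (auto simp: cotags_def elems_bind)

lemma set_colors:
  "set (elems (colors Q)) =
    set (elems Q) \<union> {tag i q b |i q b. i \<in> set (elems Q) \<and> q \<in> set (elems Q)}"
  by (auto simp: colors_def elems_bind ex_bool_eq)

text \<open>Beyond the last switch there is the empty position, not the absence of positions, so a
  choice remains possible.\<close>

definition positions_at :: "data \<Rightarrow> nat \<Rightarrow> data set" where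
  "positions_at e n = (if n < length (elems e) then set (elems (elems e ! n)) else {Leaf})"

text \<open>By distinctness the name at index \<open>n\<close> occurs only once in \<open>Q\<close>,
  so exactly one pair of the zipped list passes the comparison, and it holds the suffix beginning
  with switch \<open>n\<close>.\<close>

lemma set_merged_switch:
  assumes "distinct (elems Q)" "n < length (elems Q)"
  shows "set (elems (merged_switch Q Z (elems Q ! n))) =
    {app (rename Q (left (right z)) pos) (tags Q (elems Q ! n) (left (left z))) |z pos.
      z \<in> set (elems Z) \<and> pos \<in> positions_at (right (right z)) n}"
proof -
  let ?i = "elems Q ! n"
  have "set (elems (if left y = Leaf then Node Leaf Leaf else left (left y))) =
      positions_at e n"
    if "y = Node (list_data (drop n (elems e))) ?i" for y e
    using that by (simp add: positions_at_def left_list_data hd_drop_conv_nth)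
  moreover have "y \<in> set (elems (zips Q e)) \<and> right y = ?i \<longleftrightarrow>
      y = Node (list_data (drop n (elems e))) ?i" for y e
    using assms by (auto simp: set_zips nth_eq_iff_index_eq)
  moreover have "x \<in> set (elems (merged_switch Q Z ?i)) \<longleftrightarrow>
      (\<exists>z\<in>set (elems Z). \<exists>y. (y \<in> set (elems (zips Q (right (right z)))) \<and> right y = ?i) \<and>
        (\<exists>pos\<in>set (elems (if left y = Leaf then Node Leaf Leaf else left (left y))).
          x = app (rename Q (left (right z)) pos) (tags Q ?i (left (left z)))))" for x
    unfolding merged_switch_def elems_bind set_concat set_map
    by (auto simp: elems_bind split: if_splits)
  ultimately have "x \<in> set (elems (merged_switch Q Z ?i)) \<longleftrightarrow>
      (\<exists>z\<in>set (elems Z). \<exists>pos\<in>positions_at (right (right z)) n.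
        x = app (rename Q (left (right z)) pos) (tags Q ?i (left (left z))))" for x
    by simp
  then show ?thesis unfolding set_eq_iff mem_Collect_eq by blast
qed

lemma elems_tag: "elems (tag (unary i) (unary q) b) =
    truth b # replicate i (Node Leaf Leaf) @ Leaf # replicate q (Node Leaf Leaf)"
  by (simp add: tag_def unary_def)

text \<open>The first \<open>y\<close> ends the block of \<open>x\<close>, so block length and rest
  can be read off. It makes tags uniquely parsable.\<close>

lemma replicate_append_inject:
  "x \<noteq> y \<Longrightarrow> replicate m x @ y # xs = replicate n x @ y # ys \<longleftrightarrow> m = n \<and> xs = ys"
proof (induction m arbitrary: n)
  case 0
  then show ?case by (cases n) auto
next
  case (Suc m)
  then show ?case by (cases n) auto
qed

lemma tag_inject [simp]:
  "tag (unary i) (unary q) b = tag (unary i') (unary q') b' \<longleftrightarrow> i = i' \<and> q = q' \<and> b = b'"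
proof -
  have "tag (unary i) (unary q) b = tag (unary i') (unary q') b' \<longleftrightarrow>
    elems (tag (unary i) (unary q) b) = elems (tag (unary i') (unary q') b')"
    by (metis list_data_elems)
  then show ?thesis by (auto simp: elems_tag replicate_append_inject)
qed

text \<open>The separating zero of a tag occurs in no unary word, so tags are new colours.\<close>

lemma tag_neq_unary [simp]: "tag (unary i) (unary q) b \<noteq> unary r"
proof
  assume "tag (unary i) (unary q) b = unary r"
  then have "Leaf \<in> set (replicate r (Node Leaf Leaf))"
    by (metis elems_list_data elems_tag in_set_conv_decomp append_Cons unary_def)
  then show False by simp
qed


lemma elems_right_combine:
  "elems (right (combine Q Z)) = hub Q Z # map (merged_switch Q Z) (elems Q)"
proof -
  have "concat (map (\<lambda>x. elems (Node (f x) Leaf)) xs) = map f xs" for f and xs :: "data list"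
    by (induction xs) simp_all
  then show ?thesis by (simp add: combine_def elems_bind)
qed

lemma left_combine: "left (combine Q Z) = colors Q"
  by (simp add: combine_def)

lemma set_hub:
  "set (elems (hub Q Z)) =
    {app (rename Q (left (right z)) Leaf) (cotags Q (left (left z))) |z. z \<in> set (elems Z)}"
  by (auto simp: hub_def elems_bind)

text \<open>The colours \<open>tag i q True\<close> and \<open>tag i q False\<close> are contained only in positions of the hub
  and of the switch \<open>i\<close>.  Covering both of them forces these two switches to agree on whether \<open>q\<close>
  belongs to the identifier of the instance that the chosen position comes from.\<close>

lemma solvable_combine_iff:
  assumes dist: "distinct (elems Q)"
    and unary: "\<And>x. x \<in> set (elems Q) \<Longrightarrow> \<exists>r. x = unary r"
    and ids: "\<And>z z'. z \<in> set (elems Z) \<Longrightarrow> z' \<in> set (elems Z) \<Longrightarrow>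
      (\<And>q. q \<in> set (elems Q) \<Longrightarrow> q \<in> set (elems (left (left z))) \<longleftrightarrow> q \<in> set (elems (left (left z')))) \<Longrightarrow>
      right z = right z'"
    and small: "\<And>z. z \<in> set (elems Z) \<Longrightarrow> length (elems (left (right z))) \<le> length (elems Q) \<and>
      length (elems (right (right z))) \<le> length (elems Q)"
  shows "solvable (combine Q Z) \<longleftrightarrow> (\<exists>z\<in>set (elems Z). solvable (right z))"
proof -
  define qs where "qs = elems Q"
  define p where "p = length qs"
  define T where "T = (\<lambda>z. set (elems (left (left z))))"
  define cs where "cs = (\<lambda>z. elems (left (right z)))"
  define ss where "ss = (\<lambda>z. elems (right (right z)))"
  define ren where "ren = (\<lambda>z pos. {qs ! r |r. r < p \<and> (r < length (cs z) \<longrightarrow> cs z ! r \<in> set (elems pos))})"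
  have tag_inj: "tag i q b = tag i' q' b' \<longleftrightarrow> i = i' \<and> q = q' \<and> b = b'"
    if "i \<in> set qs" "q \<in> set qs" "i' \<in> set qs" "q' \<in> set qs" for i q b i' q' b'
    using that unary by (metis qs_def tag_inject)
  have tag_new: "tag i q b \<notin> set qs" if "i \<in> set qs" "q \<in> set qs" for i q b
    using that unary by (metis qs_def tag_neq_unary)
  have ren_sub: "ren z pos \<subseteq> set qs" for z pos by (auto simp: ren_def p_def)
  have nth_inj: "qs ! m = qs ! n \<longleftrightarrow> m = n" if "m < p" "n < p" for m n
    using that dist by (simp add: qs_def p_def nth_eq_iff_index_eq)
  \<comment> \<open>Index 0 is the hub, and index \<open>Suc n\<close> is the n-th merged
    switch.\<close>
  let ?cover = "\<lambda>ch. (\<forall>q\<in>set qs \<union> {tag i q b |i q b. i \<in> set qs \<and> q \<in> set qs}.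
    q \<in> set (elems (ch 0)) \<or> (\<exists>n<p. q \<in> set (elems (ch (Suc n)))))"
  have all: "(\<forall>n<Suc p. P n) \<longleftrightarrow> P 0 \<and> (\<forall>n<p. P (Suc n))" for P
    by (auto simp: less_Suc_eq_0_disj)
  have ex: "(\<exists>n<Suc p. P n) \<longleftrightarrow> P 0 \<or> (\<exists>n<p. P (Suc n))" for P
    by (auto simp: less_Suc_eq_0_disj)
  have "solvable (combine Q Z) \<longleftrightarrow> (\<exists>ch. ch 0 \<in> set (elems (hub Q Z)) \<and>
      (\<forall>n<p. ch (Suc n) \<in> set (elems (merged_switch Q Z (qs ! n)))) \<and> ?cover ch)"
    unfolding solvable_def coverable_def elems_right_combine left_combine set_colors list.size(4)
      length_map add_Suc_right add_0_right p_def[symmetric] qs_def[symmetric] all ex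
    by (simp add: p_def cong: conj_cong)
  also have "\<dots> \<longleftrightarrow> (\<exists>z\<in>set (elems Z). solvable (right z))"
  proof
    assume "\<exists>ch. ch 0 \<in> set (elems (hub Q Z)) \<and>
      (\<forall>n<p. ch (Suc n) \<in> set (elems (merged_switch Q Z (qs ! n)))) \<and> ?cover ch"
    then obtain ch where hub: "ch 0 \<in> set (elems (hub Q Z))"
      and sw: "\<And>n. n < p \<Longrightarrow> ch (Suc n) \<in> set (elems (merged_switch Q Z (qs ! n)))"
      and cover: "?cover ch" by blast
    obtain z0 where z0: "z0 \<in> set (elems Z)"
      "ch 0 = app (rename Q (left (right z0)) Leaf) (cotags Q (left (left z0)))"
      using hub by (auto simp: set_hub)
    have "\<exists>z pos. z \<in> set (elems Z) \<and> pos \<in> positions_at (right (right z)) n \<and>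
        ch (Suc n) = app (rename Q (left (right z)) pos) (tags Q (qs ! n) (left (left z)))"
      if "n < p" for n
    proof -
      have "n < length (elems Q)" using that by (simp add: p_def qs_def)
      from sw[OF that, unfolded qs_def set_merged_switch[OF dist this] mem_Collect_eq]
      show ?thesis unfolding qs_def by blast
    qed
    then obtain z pos where z: "\<And>n. n < p \<Longrightarrow> z n \<in> set (elems Z)"
      and pos: "\<And>n. n < p \<Longrightarrow> pos n \<in> positions_at (right (right (z n))) n"
      and ch: "\<And>n. n < p \<Longrightarrow>
        ch (Suc n) = app (rename Q (left (right (z n))) (pos n)) (tags Q (qs ! n) (left (left (z n))))"
      by metis
    have set0: "set (elems (ch 0)) = ren z0 Leaf \<union> {tag i q (q \<notin> T z0) |i q. i \<in> set qs \<and> q \<in> set qs}"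
      by (simp add: z0 set_rename set_cotags ren_def T_def qs_def p_def cs_def)
    have setS: "set (elems (ch (Suc n))) = ren (z n) (pos n) \<union> {tag (qs ! n) q (q \<in> T (z n)) |q. q \<in> set qs}"
      if "n < p" for n
      using that by (simp add: ch set_rename set_tags ren_def T_def qs_def p_def cs_def)
    have same: "right (z n) = right z0" if n: "n < p" for n
    proof (rule ids[OF z[OF n] z0(1)])
      fix q assume q: "q \<in> set (elems Q)"
      \<comment> \<open>Of the two tags for \<open>qs ! n\<close> and \<open>q\<close>, this is the
        one that the position chosen at switch \<open>n\<close> lacks. The hub has to supply it; any
        other merged switch carries tags with a different index.\<close>
      let ?t = "tag (qs ! n) q (q \<notin> T (z n))"
      have mem: "qs ! n \<in> set qs" "q \<in> set qs" using n q by (auto simp: p_def qs_def)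
      then have "?t \<in> set (elems (ch 0)) \<or> (\<exists>m<p. ?t \<in> set (elems (ch (Suc m))))"
        using cover by blast
      then show "q \<in> set (elems (left (left (z n)))) \<longleftrightarrow> q \<in> set (elems (left (left z0)))"
      proof
        assume "?t \<in> set (elems (ch 0))"
        then have "?t \<in> {tag i q (q \<notin> T z0) |i q. i \<in> set qs \<and> q \<in> set qs}"
          using tag_new[OF mem] ren_sub[of z0 Leaf] unfolding set0 by (simp only: Un_iff) (meson subsetD)
        then obtain i q' where "i \<in> set qs" "q' \<in> set qs" "?t = tag i q' (q' \<notin> T z0)" by auto
        then have "q \<notin> T (z n) \<longleftrightarrow> q \<notin> T z0" using tag_inj[OF mem] by auto
        then show ?thesis unfolding T_def by simp
      next
        assume "\<exists>m<p. ?t \<in> set (elems (ch (Suc m)))"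
        then obtain m where m: "m < p" "?t \<in> set (elems (ch (Suc m)))" by blast
        then have m': "qs ! m \<in> set qs" by (simp add: p_def)
        have "?t \<in> {tag (qs ! m) q (q \<in> T (z m)) |q. q \<in> set qs}"
          using m(2) tag_new[OF mem] ren_sub[of "z m" "pos m"] unfolding setS[OF m(1)]
          by (simp only: Un_iff) (meson subsetD)
        then obtain q' where "q' \<in> set qs" "?t = tag (qs ! m) q' (q' \<in> T (z m))" by auto
        then have "qs ! n = qs ! m" "q \<notin> T (z n) \<longleftrightarrow> q \<in> T (z m)"
          using tag_inj[OF mem m'] by auto
        then show ?thesis using nth_inj n m by simp
      qed
    qed
    have "solvable (right z0)"
      unfolding solvable_def coverable_def
    proof (rule exI[of _ pos], intro conjI allI impI ballI)
      fix n assume n: "n < length (elems (right (right z0)))"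
      then have "n < p" using small[OF z0(1)] by (simp add: p_def qs_def)
      then show "pos n \<in> set (elems (elems (right (right z0)) ! n))"
        using pos[of n] n same[of n] by (simp add: positions_at_def ss_def)
    next
      fix c assume "c \<in> set (elems (left (right z0)))"
      then obtain r where r: "r < length (cs z0)" "c = cs z0 ! r"
        by (auto simp: cs_def in_set_conv_nth)
      then have rp: "r < p" using small[OF z0(1)] by (simp add: p_def qs_def cs_def)
      then have rq: "qs ! r \<in> set qs" by (simp add: p_def)
      then have "qs ! r \<in> set (elems (ch 0)) \<or> (\<exists>n<p. qs ! r \<in> set (elems (ch (Suc n))))"
        using cover by blast
      \<comment> \<open>The hub offers padding names only, and \<open>r\<close> is the index of a
        genuine colour.\<close>
      moreover have "qs ! r \<notin> set (elems (ch 0))"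
        using rq tag_new r rp nth_inj by (auto simp: set0 ren_def)
      ultimately obtain n where n: "n < p" "qs ! r \<in> set (elems (ch (Suc n)))" by blast
      moreover have "qs ! r \<noteq> tag (qs ! n) q b" if "q \<in> set qs" for q b
        using tag_new[of "qs ! n" q b] that n rq by (metis nth_mem p_def)
      ultimately have "qs ! r \<in> ren (z n) (pos n)" using setS[OF n(1)] by blast
      then have "c \<in> set (elems (pos n))"
        using r rp nth_inj same[OF n(1)] by (auto simp: ren_def cs_def)
      \<comment> \<open>At a padded switch the only position is empty, so a position that contains
        \<open>c\<close> belongs to a genuine switch.\<close>
      moreover have "n < length (ss (z n))"
        using calculation pos[OF n(1)] by (auto simp: positions_at_def ss_def split: if_splits)
      ultimately show "\<exists>n<length (elems (right (right z0))). c \<in> set (elems (pos n))"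
        using same[OF n(1)] by (auto simp: ss_def)
    qed
    with z0(1) show "\<exists>z\<in>set (elems Z). solvable (right z)" by blast
  next
    assume "\<exists>z\<in>set (elems Z). solvable (right z)"
    then obtain z f where z: "z \<in> set (elems Z)"
      and f: "\<And>n. n < length (ss z) \<Longrightarrow> f n \<in> set (elems (ss z ! n))"
      and cov: "\<And>c. c \<in> set (cs z) \<Longrightarrow> \<exists>n<length (ss z). c \<in> set (elems (f n))"
      unfolding solvable_def coverable_def ss_def cs_def by blast
    \<comment> \<open>\<open>Leaf\<close> is the empty position of the padded switches.\<close>
    define pos where "pos = (\<lambda>n. if n < length (ss z) then f n else Leaf)"
    define ch where "ch = (\<lambda>n. case n of 0 \<Rightarrow> app (rename Q (left (right z)) Leaf) (cotags Q (left (left z)))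
      | Suc n \<Rightarrow> app (rename Q (left (right z)) (pos n)) (tags Q (qs ! n) (left (left z))))"
    have set0: "set (elems (ch 0)) = ren z Leaf \<union> {tag i q (q \<notin> T z) |i q. i \<in> set qs \<and> q \<in> set qs}"
      by (simp add: ch_def set_rename set_cotags ren_def T_def qs_def p_def cs_def)
    have setS: "set (elems (ch (Suc n))) = ren z (pos n) \<union> {tag (qs ! n) q (q \<in> T z) |q. q \<in> set qs}" for n
      by (simp add: ch_def set_rename set_tags ren_def T_def qs_def p_def cs_def)
    have "ch 0 \<in> set (elems (hub Q Z))" using z by (auto simp: set_hub ch_def)
    moreover have "ch (Suc n) \<in> set (elems (merged_switch Q Z (qs ! n)))" if "n < p" for n
    proof -
      have "pos n \<in> positions_at (right (right z)) n" using f by (simp add: pos_def positions_at_def ss_def)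
      moreover have "n < length (elems Q)" using that by (simp add: p_def qs_def)
      ultimately show ?thesis
        using z unfolding ch_def qs_def nat.case set_merged_switch[OF dist \<open>n < length (elems Q)\<close>] by blast
    qed
    moreover have "?cover ch"
    proof
      fix x assume "x \<in> set qs \<union> {tag i q b |i q b. i \<in> set qs \<and> q \<in> set qs}"
      then consider "x \<in> set qs" | i q b where "i \<in> set qs" "q \<in> set qs" "x = tag i q b" by blast
      then consider r where "r < p" "x = qs ! r" | n q b where "n < p" "q \<in> set qs" "x = tag (qs ! n) q b"
        by cases (metis in_set_conv_nth p_def)+
      then show "x \<in> set (elems (ch 0)) \<or> (\<exists>n<p. x \<in> set (elems (ch (Suc n))))"
      proof cases
        case 1
        show ?thesis
        proof (cases "r < length (cs z)")
          case True
          then obtain n where n: "n < length (ss z)" "cs z ! r \<in> set (elems (f n))"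
            using cov[of "cs z ! r"] by auto
          then have "x \<in> ren z (pos n)" using 1 by (auto simp: ren_def pos_def)
          moreover have "n < p" using n small[OF z] by (simp add: ss_def p_def qs_def)
          ultimately show ?thesis by (auto simp: setS)
        next
          case False
          then have "x \<in> ren z Leaf" using 1 by (auto simp: ren_def)
          then show ?thesis by (simp add: set0)
        qed
      next
        case 2
        then have "qs ! n \<in> set qs" by (simp add: p_def)
        \<comment> \<open>The tag is supplied by switch \<open>n\<close> if \<open>b\<close> is the
          true answer for \<open>q\<close>, and by the hub otherwise.\<close>
        with 2 show ?thesis unfolding set0 setS by (cases "b = (q \<in> T z)") auto
      qed
    qed
    ultimately show "\<exists>ch. ch 0 \<in> set (elems (hub Q Z)) \<and>
      (\<forall>n<p. ch (Suc n) \<in> set (elems (merged_switch Q Z (qs ! n)))) \<and> ?cover ch" by blast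
  qed
  finally show ?thesis .
qed

section \<open>Codes and instances\<close>

text \<open>A condition on the tree itself that guarantees an instance behind it.
  \<open>Leaf\<close> is excluded explicitly: both of its components are \<open>Leaf\<close>, so the
  other conditions would take it for an empty instance.\<close>

definition wf_code :: "data \<Rightarrow> bool" where
  "wf_code d \<longleftrightarrow> d \<noteq> Leaf \<and> distinct (elems (left d)) \<and> set (elems (left d)) \<subseteq> range nat_data \<and>
    (\<forall>s\<in>set (elems (right d)). \<forall>p\<in>set (elems s). set (elems p) \<subseteq> set (elems (left d)))"

text \<open>Both sides use switches and positions only through membership, which does not depend on
  the order of listing and is preserved by the injective \<open>nat_data\<close>.\<close>

lemma ssc_yes_iff_solvable:
  assumes "ssc_encodes d (C, S)" "(C, S) \<in> ssc_instances"
  shows "(C, S) \<in> ssc_yes \<longleftrightarrow> solvable d"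
proof -
  obtain cs ss where CS: "C = set cs" "S = map (\<lambda>s. mset (map mset s)) ss"
    and d: "d = Node (list_data (map nat_data cs)) (list_data (map switch_data ss))"
    using assms(1) by auto
  have mem: "nat_data c \<in> set (elems (position_data p)) \<longleftrightarrow> c \<in> set p" for c p
    by (auto simp: position_data_def inj_eq[OF inj_nat_data])
  show ?thesis
  proof
    assume "(C, S) \<in> ssc_yes"
    then obtain choice where ch: "\<And>i. i < length ss \<Longrightarrow> choice i \<in> mset ` set (ss ! i)"
      and cov: "\<And>c. c \<in> set cs \<Longrightarrow> \<exists>i<length ss. c \<in># choice i"
      by (auto simp: ssc_yes_def CS)
    from ch have "\<forall>i. \<exists>p. i < length ss \<longrightarrow> p \<in> set (ss ! i) \<and> choice i = mset p" by blast
    then obtain p where p: "\<And>i. i < length ss \<Longrightarrow> p i \<in> set (ss ! i) \<and> choice i = mset (p i)" by metis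
    show "solvable d"
      unfolding solvable_def coverable_def
    proof (rule exI[of _ "\<lambda>i. position_data (p i)"], intro conjI allI impI ballI)
      fix n assume "n < length (elems (right d))"
      then show "position_data (p n) \<in> set (elems (elems (right d) ! n))"
        using p by (simp add: d switch_data_def)
    next
      fix c assume "c \<in> set (elems (left d))"
      then obtain x where x: "x \<in> set cs" "c = nat_data x" by (auto simp: d)
      then obtain i where "i < length ss" "x \<in># choice i" using cov by blast
      then show "\<exists>n<length (elems (right d)). c \<in> set (elems (position_data (p n)))"
        using p x by (auto simp: d mem)
    qed
  next
    assume "solvable d"
    then obtain ch where ch: "\<And>i. i < length ss \<Longrightarrow> ch i \<in> position_data ` set (ss ! i)"
      and cov: "\<And>c. c \<in> set cs \<Longrightarrow> \<exists>i<length ss. nat_data c \<in> set (elems (ch i))"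
      by (auto simp: solvable_def coverable_def d switch_data_def)
    from ch have "\<forall>i. \<exists>p. i < length ss \<longrightarrow> p \<in> set (ss ! i) \<and> ch i = position_data p" by blast
    then obtain p where p: "\<And>i. i < length ss \<Longrightarrow> p i \<in> set (ss ! i) \<and> ch i = position_data (p i)" by metis
    have "\<exists>choice. (\<forall>i<length S. choice i \<in># S ! i) \<and> (\<forall>c\<in>C. \<exists>i<length S. c \<in># choice i)"
    proof (rule exI[of _ "\<lambda>i. mset (p i)"], intro conjI allI impI ballI)
      fix i assume "i < length S"
      then show "mset (p i) \<in># S ! i" using p by (auto simp: CS)
    next
      fix c assume "c \<in> C"
      then obtain i where "i < length ss" "nat_data c \<in> set (elems (ch i))" using cov CS by blast
      then show "\<exists>i<length S. c \<in># mset (p i)" using p mem by (auto simp: CS)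
    qed
    with assms(2) show "(C, S) \<in> ssc_yes" by (simp add: ssc_yes_def)
  qed
qed

lemma ssc_parameter_eq:
  assumes "ssc_encodes d (C, S)"
  shows "ssc_parameter (C, S) = length (elems (left d)) + length (elems (right d))"
  using assms by (auto simp: distinct_card)

lemma distinct_left_code: "ssc_encodes d (C, S) \<Longrightarrow> distinct (elems (left d))"
  using inj_nat_data by (auto simp: distinct_map inj_on_def inj_def)

lemma wf_code_encodes:
  assumes "wf_code d"
  shows "\<exists>I\<in>ssc_instances. ssc_encodes d I"
proof -
  define dec where "dec = inv nat_data"
  define cs where "cs = map dec (elems (left d))"
  define ss where "ss = map (\<lambda>s. map (\<lambda>p. map dec (elems p)) (elems s)) (elems (right d))"
  have dec: "nat_data (dec x) = x" if "x \<in> set (elems (left d))" for x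
    using that assms by (auto simp: wf_code_def dec_def f_inv_into_f)
  have cs: "map nat_data cs = elems (left d)"
    by (simp add: cs_def o_def map_idI dec)
  have "position_data (map dec (elems p)) = p" if "s \<in> set (elems (right d))" "p \<in> set (elems s)" for s p
  proof -
    have "set (elems p) \<subseteq> set (elems (left d))" using that assms unfolding wf_code_def by blast
    then have "map (\<lambda>x. nat_data (dec x)) (elems p) = elems p"
      by (intro map_idI dec) blast
    then show ?thesis by (simp add: position_data_def o_def)
  qed
  then have "switch_data (map (\<lambda>p. map dec (elems p)) (elems s)) = s" if "s \<in> set (elems (right d))" for s
    using that by (simp add: switch_data_def o_def map_idI)
  then have ss: "map switch_data ss = elems (right d)"
    by (simp add: ss_def o_def map_idI)
  let ?I = "(set cs, map (\<lambda>s. mset (map mset s)) ss)"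
  have "d = Node (left d) (right d)" using assms by (cases d) (auto simp: wf_code_def)
  moreover have "distinct cs"
    using assms cs by (metis distinct_map wf_code_def)
  ultimately have "ssc_encodes d ?I"
    unfolding ssc_encodes.simps using cs ss by (metis list_data_elems)
  moreover have "?I \<in> ssc_instances"
    using assms by (fastforce simp: ssc_instances_def is_switch_def is_position_def ss_def cs_def wf_code_def)
  ultimately show ?thesis by blast
qed

text \<open>With the least significant bit first, a one put in front turns n into 2n + 1; the word
  of r ones encodes 2^r - 1.\<close>

lemma unary_in_range_nat_data: "unary (Suc r) \<in> range nat_data"
proof (induction r)
  case 0
  have "unary (Suc 0) = nat_data 1" by (simp add: unary_def nat_data_pos nat_data_0)
  then show ?case by blast
next
  case (Suc r)
  then obtain n where "unary (Suc r) = nat_data n" by blast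
  then have "unary (Suc (Suc r)) = nat_data (2 * n + 1)"
    by (simp add: unary_def nat_data_pos)
  then show ?case by blast
qed

text \<open>For \<open>Leaf\<close>, a zero in front would become the most significant bit, which no
  binary code has.\<close>

lemma Node_in_range_nat_data:
  assumes "x \<in> range nat_data" "x \<noteq> Leaf"
  shows "Node (truth b) x \<in> range nat_data"
proof -
  obtain n where n: "x = nat_data n" "n \<noteq> 0" using assms nat_data_0 by (metis rangeE)
  then have "Node (truth b) x = nat_data (if b then 2 * n + 1 else 2 * n)"
    using nat_data_pos[of "2 * n"] nat_data_pos[of "2 * n + 1"] by (simp add: truth_def)
  then show ?thesis by blast
qed

text \<open>The word of a tag ends in at least one 1, so its most significant bit is set and
  arbitrary bits may precede it. This is why names have positive length.\<close>

lemma tag_in_range_nat_data: "tag (unary i) (unary (Suc q)) b \<in> range nat_data"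
proof -
  have app: "app (unary i) x \<in> range nat_data \<and> app (unary i) x \<noteq> Leaf"
    if "x \<in> range nat_data" "x \<noteq> Leaf" for x
  proof (induction i)
    case 0
    have "app (unary 0) x = x" by (metis elems_app list_data_elems append_Nil elems_list_data replicate_0 unary_def)
    with that show ?case by simp
  next
    case (Suc i)
    have "app (unary (Suc i)) x = Node (truth True) (app (unary i) x)"
      by (simp add: app_def bind_def unary_def truth_def)
    with Suc show ?case using Node_in_range_nat_data by simp
  qed
  have "unary (Suc q) \<noteq> Leaf" by (simp add: unary_def)
  then have "Node Leaf (unary (Suc q)) \<in> range nat_data"
    using Node_in_range_nat_data[OF unary_in_range_nat_data, of q False] by (simp add: truth_def)
  then show ?thesis
    unfolding tag_def using app Node_in_range_nat_data by blast
qed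

lemma distinct_concat_map:
  assumes "distinct xs" "\<And>x. x \<in> set xs \<Longrightarrow> distinct (f x)"
    and "\<And>x y. x \<in> set xs \<Longrightarrow> y \<in> set xs \<Longrightarrow> x \<noteq> y \<Longrightarrow> set (f x) \<inter> set (f y) = {}"
  shows "distinct (concat (map f xs))"
  using assms by (induction xs) (simp, fastforce)

lemma wf_code_combine:
  assumes dist: "distinct (elems Q)"
    and unary: "\<And>x. x \<in> set (elems Q) \<Longrightarrow> \<exists>r. x = unary (Suc r)"
  shows "wf_code (combine Q Z)"
  unfolding wf_code_def left_combine
proof (intro conjI ballI)
  show "combine Q Z \<noteq> Leaf" by (simp add: combine_def)
  obtain f where f: "\<And>x. x \<in> set (elems Q) \<Longrightarrow> x = unary (Suc (f x))" using unary by metis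
  have tag_inj: "tag i q b = tag i' q' b' \<longleftrightarrow> i = i' \<and> q = q' \<and> b = b'"
    if "i \<in> set (elems Q)" "q \<in> set (elems Q)" "i' \<in> set (elems Q)" "q' \<in> set (elems Q)" for i q b i' q' b'
    using that unary by (metis tag_inject)
  have tag_new: "tag i q b \<notin> set (elems Q)" if "i \<in> set (elems Q)" "q \<in> set (elems Q)" for i q b
    using that unary by (metis tag_neq_unary)
  have "distinct (concat (map (\<lambda>i. concat (map (\<lambda>q. [tag i q True, tag i q False]) (elems Q))) (elems Q)))"
    using dist by (intro distinct_concat_map) (auto simp: tag_inj)
  then show "distinct (elems (colors Q))"
    using dist tag_new by (auto simp: colors_def elems_bind)
  show "set (elems (colors Q)) \<subseteq> range nat_data"
  proof
    fix x assume "x \<in> set (elems (colors Q))"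
    then consider "x \<in> set (elems Q)" | i q b where "i \<in> set (elems Q)" "q \<in> set (elems Q)" "x = tag i q b"
      by (auto simp: set_colors)
    then show "x \<in> range nat_data"
      by cases (metis f unary_in_range_nat_data, metis f tag_in_range_nat_data)
  qed
  fix s p assume s: "s \<in> set (elems (right (combine Q Z)))" and p: "p \<in> set (elems s)"
  have ren: "set (elems (rename Q cs pos)) \<subseteq> set (elems Q)" for cs pos
    by (auto simp: set_rename)
  from s consider "s = hub Q Z" | n where "n < length (elems Q)" "s = merged_switch Q Z (elems Q ! n)"
    by (auto simp: elems_right_combine in_set_conv_nth)
  then show "set (elems p) \<subseteq> set (elems (colors Q))"
  proof cases
    case 1
    with p obtain z where "p = app (rename Q (left (right z)) Leaf) (cotags Q (left (left z)))"
      by (auto simp: set_hub)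
    then show ?thesis using ren[of "left (right z)" Leaf] by (auto simp: set_cotags set_colors)
  next
    case 2
    with p obtain z pos where p: "p = app (rename Q (left (right z)) pos) (tags Q (elems Q ! n) (left (left z)))"
      by (auto simp: set_merged_switch[OF dist])
    have "elems Q ! n \<in> set (elems Q)" using 2(1) by simp
    then show ?thesis
      using ren[of "left (right z)" pos] unfolding p elems_app set_append set_tags set_colors by blast
  qed
qed

text \<open>The p names and 2p^2 tags are the colours; the hub adds one to the p merged
  switches.\<close>

lemma size_combine:
  "length (elems (left (combine Q Z))) + length (elems (right (combine Q Z))) =
    poly [:1, 2, 2:] (length (elems Q))"
  by (simp add: left_combine elems_right_combine colors_def elems_bind length_concat comp_def
      sum_list_triv algebra_simps)

section \<open>Correctness of the composed instance\<close>

lemma compose_correct: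
  assumes Is: "Is \<noteq> []" "set Is \<subseteq> ssc_instances" "\<And>I. I \<in> set Is \<Longrightarrow> ssc_parameter I = p"
    and ds: "list_all2 ssc_encodes ds Is"
  shows "wf_code (compose (list_data ds)) \<and>
    length (elems (left (compose (list_data ds)))) + length (elems (right (compose (list_data ds))))
      \<le> poly [:1, 2, 2:] p \<and>
    (solvable (compose (list_data ds)) \<longleftrightarrow> (\<exists>d\<in>set ds. solvable d))"
proof -
  let ?L = "list_data ds"
  define Q where "Q = color_names ?L"
  have enc: "\<exists>I\<in>set Is. ssc_encodes d I" if "d \<in> set ds" for d
    using ds that by (metis in_set_conv_nth list_all2_conv_all_nth)
  have par: "length (elems (left d)) + length (elems (right d)) = p" if "d \<in> set ds" for d
    using enc[OF that] ssc_parameter_eq Is(3) by (metis surj_pair)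
  have dist: "distinct (elems (left d))" if "d \<in> set ds" for d
    using enc[OF that] distinct_left_code by (metis surj_pair)
  have "ds \<noteq> []" using Is(1) ds by auto
  then have "left ?L \<in> set ds" by (cases ds) simp_all
  then have len_Q: "length (elems Q) = p"
    using par by (simp add: Q_def color_names_def)
  have dist_Q: "distinct (elems Q)" by (simp add: Q_def color_names_def distinct_names)
  have unary_Q: "\<exists>r. x = unary (Suc r)" if "x \<in> set (elems Q)" for x
    using that names_unary unfolding Q_def color_names_def by blast
  let ?V = "subsets ?L Q"
  show ?thesis
  proof (cases "length (elems ?V) < length ds")
    case True
    have "solvable_by_table ?L d \<longleftrightarrow> solvable d" if "d \<in> set ds" for d
    proof (rule solvable_by_table_iff)
      have "length (elems (subsets ?L (left d))) \<le> length (elems ?V)"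
        using length_subsets_mono[of "elems (left d)" "elems Q" ?L] len_Q par[OF that] by simp
      then show "length (elems (subsets ?L (left d))) < length (elems ?L)" using True by simp
    qed
    then have compose: "compose ?L = (if \<exists>d\<in>set ds. solvable d then Node Leaf Leaf
        else Node Leaf (Node Leaf Leaf))"
      using True by (simp add: compose_def Q_def[symmetric] cong: bex_cong)
    have "solvable (Node Leaf Leaf)" "\<not> solvable (Node Leaf (Node Leaf Leaf))"
      by (auto simp: solvable_def coverable_def)
    then show ?thesis unfolding compose by (simp add: wf_code_def)
  next
    \<comment> \<open>There are at least as many subsets as instances, so the n-th instance takes
      the n-th subset as its identifier.\<close>
    case False
    let ?Z = "zips ?L ?V"
    have compose: "compose ?L = combine Q ?Z"
      using False by (simp add: compose_def Q_def[symmetric])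
    have Z: "set (elems ?Z) = {Node (list_data (drop n (elems ?V))) (ds ! n) |n. n < length ds}"
      by (simp add: set_zips)
    have left_Z: "left (list_data (drop n (elems ?V))) = elems ?V ! n" if "n < length ds" for n
      using that False by (simp add: left_list_data hd_drop_conv_nth)
    have "solvable (combine Q ?Z) \<longleftrightarrow> (\<exists>z\<in>set (elems ?Z). solvable (right z))"
    proof (rule solvable_combine_iff[OF dist_Q])
      show "\<exists>r. x = unary r" if "x \<in> set (elems Q)" for x using unary_Q[OF that] by blast
    next
      fix z z' assume "z \<in> set (elems ?Z)" "z' \<in> set (elems ?Z)"
      then obtain m n where mn: "m < length ds" "n < length ds"
        "z = Node (list_data (drop m (elems ?V))) (ds ! m)" "z' = Node (list_data (drop n (elems ?V))) (ds ! n)"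
        by (auto simp: Z)
      assume eq: "\<And>q. q \<in> set (elems Q) \<Longrightarrow> q \<in> set (elems (left (left z))) \<longleftrightarrow> q \<in> set (elems (left (left z')))"
      have V: "elems ?V ! i \<in> set (elems ?V)" "set (elems (elems ?V ! i)) \<subseteq> set (elems Q)"
        if "i < length ds" for i
        using that False subsets_subset[of "elems ?V ! i" ?L "elems Q"] by auto
      \<comment> \<open>Agreement on \<open>Q\<close> is equality, since identifiers are subsets of
        \<open>Q\<close>.\<close>
      have "set (elems (elems ?V ! m)) = set (elems (elems ?V ! n))"
        using eq V(2)[OF mn(1)] V(2)[OF mn(2)] by (auto simp: mn left_Z[OF mn(1)] left_Z[OF mn(2)])
      then have "elems ?V ! m = elems ?V ! n"
        using inj_on_set_subsets[OF dist_Q, of ?L] V(1)[OF mn(1)] V(1)[OF mn(2)] by (auto dest: inj_onD)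
      then have "m = n"
        using inj_on_set_subsets[OF dist_Q, of ?L] mn False by (simp add: nth_eq_iff_index_eq)
      then show "right z = right z'" by (simp add: mn)
    next
      fix z assume "z \<in> set (elems ?Z)"
      then have "right z \<in> set ds" by (auto simp: Z)
      then show "length (elems (left (right z))) \<le> length (elems Q) \<and>
          length (elems (right (right z))) \<le> length (elems Q)"
        using par[of "right z"] len_Q by simp
    qed
    also have "\<dots> \<longleftrightarrow> (\<exists>d\<in>set ds. solvable d)"
      by (force simp: Z in_set_conv_nth)
    finally show ?thesis
      unfolding compose using wf_code_combine[OF dist_Q unary_Q] by (simp add: size_combine len_Q)
  qed
qed

theorem mainTheorem19: "or_compositional switch_set_cover"
proof -
  obtain A N b where b: "poly_bounded b"
    and A: "\<And>s. \<exists>s'. runs A s (b (s 0)) s' \<and> s' 0 = compose (s 0) \<and> (\<forall>x\<ge>N. s' x = s x)"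
    by (rule polytimeE[OF polytime_compose]) (rule that)
  obtain q where q: "\<And>d. b d \<le> poly q (data_size d)" using b unfolding poly_bounded_def by blast
  have "or_composition_algorithm A switch_set_cover"
    unfolding or_composition_algorithm_def
  \<comment> \<open>\<open>list_data\<close> adds one node per entry and a final
    \<open>Leaf\<close>; as every entry has size at least 1, the input has size at most 1 + 2n,
    where n is the sum of the sizes of the entries. The other polynomial comes from
    \<open>size_combine\<close>.\<close>
  proof (rule exI[of _ "pcompose q [:1, 2:]"], rule exI[of _ "[:1, 2, 2:]"], intro allI impI)
    fix Is :: "ssc_instance list" and ds p
    let ?d = "compose (list_data ds)"
    assume "Is \<noteq> [] \<and> set Is \<subseteq> instances switch_set_cover \<and>
      (\<forall>I\<in>set Is. parameter switch_set_cover I = p) \<and> list_all2 (encodes switch_set_cover) ds Is"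
    then have Is: "Is \<noteq> []" "set Is \<subseteq> ssc_instances" "\<And>I. I \<in> set Is \<Longrightarrow> ssc_parameter I = p"
      "list_all2 ssc_encodes ds Is"
      by (simp_all add: switch_set_cover_def)
    from compose_correct[OF this] have wf: "wf_code ?d"
      and size: "length (elems (left ?d)) + length (elems (right ?d)) \<le> poly [:1, 2, 2:] p"
      and iff: "solvable ?d \<longleftrightarrow> (\<exists>d\<in>set ds. solvable d)" by blast+
    obtain C S where J: "(C, S) \<in> ssc_instances" "ssc_encodes ?d (C, S)"
      using wf_code_encodes[OF wf] by (metis surj_pair)
    have yes: "I \<in> ssc_yes \<longleftrightarrow> solvable d" if "ssc_encodes d I" "I \<in> ssc_instances" for d I
      using that ssc_yes_iff_solvable by (metis surj_pair)
    have "(\<exists>d\<in>set ds. solvable d) \<longleftrightarrow> (\<exists>I\<in>set Is. I \<in> ssc_yes)"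
      using Is(4,2) yes by (induction rule: list_all2_induct) auto
    then have "(C, S) \<in> ssc_yes \<longleftrightarrow> (\<exists>I\<in>set Is. I \<in> ssc_yes)"
      using iff yes[OF J(2,1)] by simp
    moreover have "ssc_parameter (C, S) \<le> poly [:1, 2, 2:] p"
      using size unfolding ssc_parameter_eq[OF J(2)] .
    moreover obtain t where "computes_in A (list_data ds) ?d t" "t \<le> b (list_data ds)"
      using A[of "(\<lambda>_. Leaf)(0 := list_data ds)"] unfolding computes_in_def runs_def by auto
    moreover have "b (list_data ds) \<le> poly (pcompose q [:1, 2:]) (sum_list (map data_size ds) + p)"
    proof -
      have "(\<Sum>d\<leftarrow>ds. 1 + data_size d) \<le> (\<Sum>d\<leftarrow>ds. 2 * data_size d)"
        using data_size_pos by (intro sum_list_mono) (simp add: Suc_le_eq)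
      then have "data_size (list_data ds) \<le> 1 + 2 * (sum_list (map data_size ds) + p)"
        by (simp add: data_size_list_data sum_list_const_mult)
      from le_trans[OF q poly_nat_mono[OF this]] show ?thesis
        by (simp add: poly_pcompose mult.commute)
    qed
    ultimately show "\<exists>d t J. computes_in A (list_data ds) d t \<and>
        t \<le> poly (pcompose q [:1, 2:]) (sum_list (map data_size ds) + p) \<and>
        J \<in> instances switch_set_cover \<and> encodes switch_set_cover d J \<and>
        parameter switch_set_cover J \<le> poly [:1, 2, 2:] p \<and>
        (J \<in> yes_instances switch_set_cover \<longleftrightarrow> (\<exists>I\<in>set Is. I \<in> yes_instances switch_set_cover))"
      using J by (intro exI[of _ ?d] exI[of _ t] exI[of _ "(C, S)"]) (simp add: switch_set_cover_def)
  qed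
  then show ?thesis unfolding or_compositional_def by blast
qed

end
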